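(* Let $(d,n,\theta)$ be such that $\theta<1$ and one of the following holds: $d=1$, $n\ge1$, $\theta\in[1-1/(2n),1]$; or $d=2$, $n=1$, $\theta\in(0,1]$; or $d\ge3$, $n=1$, $\theta\in[0,1]$. Let $V:\mathbb{Z}^d\to\mathbb{R}$ satisfy $V(k)\ge0$ and $V(k)\to0$ as $|k|\to\infty$, and consider the discrete Schrödinger operator $$Hu(k)=(-1)^n\Delta^nu(k)-V(k)u(k),\qquad u\in l^2(\mathbb{Z}^d).$$ Then the negative spectrum of $H$ is discrete and satisfies the estimate $$\sum_{j}|\lambda_j|\le\mathrm{K}(\theta)\,\frac{(1-\theta)^{1-\theta}}{(2-\theta)^{2-\theta}}\sum_{k\in\mathbb{Z}^d}V(k)^{2-\theta},$$ where the sum on the left is over the negative eigenvalues $\lambda_j$ of $H$ counted with multiplicity.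
   Context: Sequences are real-valued; $\|\cdot\|$ is the $l^2$-norm. $\mathrm{D}_iu(k)=u(k+e_i)-u(k)$, $\nabla u=(\mathrm{D}_1u,\dots,\mathrm{D}_du)$, $\|\nabla u\|^2=\sum_i\|\mathrm{D}_iu\|^2$, $-\Delta=\sum_{i=1}^d\mathrm{D}_i^*\mathrm{D}_i$, and $\mathcal{D}^n:=\Delta^{n/2}$ for $n$ even, $\mathcal{D}^n:=\nabla\Delta^{(n-1)/2}$ for $n$ odd. $\mathrm{K}(\theta)=\mathrm{K}(\theta;d,n)$ denotes the sharp (smallest) constant in the inequality $$\sup_{k\in\mathbb{Z}^d}u(k)^2\le\mathrm{K}(\theta)\,\|u\|^{2\theta}\,\|\mathcal{D}^nu\|^{2(1-\theta)}\qquad\text{for all }u\in l^2(\mathbb{Z}^d),$$ which is finite for the listed $(d,n,\theta)$. The right-hand side of the estimate may be $+\infty$, in which case the estimate is trivial. *)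

theory Defs
  imports "HOL-Analysis.Analysis" "HOL-Library.Function_Algebras"
begin

instantiation "fun" :: (type, real_vector) real_vector
begin

definition scaleR_fun :: "real \<Rightarrow> ('a \<Rightarrow> 'b) \<Rightarrow> 'a \<Rightarrow> 'b" where
  "scaleR_fun c f = (\<lambda>x. c *\<^sub>R f x)"

instance
  by standard (auto simp: scaleR_fun_def fun_eq_iff algebra_simps)

end

definition l2 :: "('a \<Rightarrow> real) set" where
  "l2 = {u. (\<lambda>k. (u k)\<^sup>2) summable_on UNIV}"

definition l2_norm :: "('a \<Rightarrow> real) \<Rightarrow> real" where
  "l2_norm u = sqrt (\<Sum>\<^sub>\<infinity>k. (u k)\<^sup>2)"


section \<open>Difference operators on the lattice\<close>

text \<open>The lattice is \<open>int ^ 'd\<close>, so that the dimension is \<open>CARD('d)\<close>.\<close>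

definition diff_op :: "'d \<Rightarrow> (int ^ 'd \<Rightarrow> real) \<Rightarrow> (int ^ 'd::finite \<Rightarrow> real)" where
  "diff_op i u = (\<lambda>k. u (k + axis i 1) - u k)"

definition diff_adj :: "'d \<Rightarrow> (int ^ 'd \<Rightarrow> real) \<Rightarrow> (int ^ 'd::finite \<Rightarrow> real)" where
  "diff_adj i u = (\<lambda>k. u (k - axis i 1) - u k)"

lemma l2_mult_summable:
  assumes "u \<in> l2" "v \<in> l2"
  shows "(\<lambda>k. u k * v k) summable_on UNIV"
proof -
  have "(\<lambda>k. (u k)\<^sup>2 + (v k)\<^sup>2) summable_on UNIV"
    using assms unfolding l2_def by (auto intro: summable_on_add)
  moreover have "norm (u k * v k) \<le> (u k)\<^sup>2 + (v k)\<^sup>2" for k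
  proof -
    have "0 \<le> (\<bar>u k\<bar> - \<bar>v k\<bar>)\<^sup>2" "0 \<le> \<bar>u k\<bar> * \<bar>v k\<bar>" by auto
    then show ?thesis unfolding real_norm_def abs_mult power2_diff power2_abs by linarith
  qed
  ultimately have "(\<lambda>k. norm (u k * v k)) summable_on UNIV"
    by (rule Infinite_Sum.abs_summable_on_comparison_test')
  then show ?thesis
    by (rule abs_summable_summable)
qed

lemma l2_shift:
  fixes u :: "int ^ 'd::finite \<Rightarrow> real"
  assumes "u \<in> l2"
  shows "(\<lambda>k. u (k + a)) \<in> l2"
  using assms summable_on_reindex_bij_betw[of "\<lambda>k. k + a" UNIV UNIV "\<lambda>k. (u k)\<^sup>2"]
  by (simp add: l2_def bij_plus_right)

text \<open>\<^const>\<open>diff_adj\<close> is the Hilbert space adjoint of \<^const>\<open>diff_op\<close>.\<close>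

lemma diff_op_adjoint:
  fixes u v :: "int ^ 'd::finite \<Rightarrow> real"
  assumes u: "u \<in> l2" and v: "v \<in> l2"
  shows "(\<Sum>\<^sub>\<infinity>k. diff_op i u k * v k) = (\<Sum>\<^sub>\<infinity>k. u k * diff_adj i v k)"
proof -
  let ?e = "axis i 1 :: int ^ 'd"
  have bij: "bij (\<lambda>k. k + ?e)"
    by (rule bij_plus_right)
  have s: "(\<lambda>k. u (k + ?e) * v k) summable_on UNIV" "(\<lambda>k. u k * v k) summable_on UNIV"
          "(\<lambda>k. u k * v (k - ?e)) summable_on UNIV"
    using l2_mult_summable[OF l2_shift[OF u, of ?e] v] l2_mult_summable[OF u v]
      l2_mult_summable[OF u l2_shift[OF v, of "- ?e"]] by simp_all
  have diff: "(\<Sum>\<^sub>\<infinity>k. f k - g k) = (\<Sum>\<^sub>\<infinity>k. f k) - (\<Sum>\<^sub>\<infinity>k. g k)"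
    if "f summable_on UNIV" "g summable_on UNIV" for f g :: "int ^ 'd \<Rightarrow> real"
    using infsum_add[OF that(1), of "\<lambda>k. - g k"] that(2)
    by (simp add: infsum_uminus summable_on_uminus)
  have "(\<Sum>\<^sub>\<infinity>k. diff_op i u k * v k) = (\<Sum>\<^sub>\<infinity>k. u (k + ?e) * v k) - (\<Sum>\<^sub>\<infinity>k. u k * v k)"
    unfolding diff_op_def left_diff_distrib
    by (rule diff) (use s in auto)
  also have "(\<Sum>\<^sub>\<infinity>k. u (k + ?e) * v k) = (\<Sum>\<^sub>\<infinity>k. u k * v (k - ?e))"
    using infsum_reindex_bij_betw[OF bij, of "\<lambda>k. u k * v (k - ?e)"] by simp
  also have "\<dots> - (\<Sum>\<^sub>\<infinity>k. u k * v k) = (\<Sum>\<^sub>\<infinity>k. u k * diff_adj i v k)"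
    unfolding diff_adj_def right_diff_distrib
    by (rule diff[symmetric]) (use s in auto)
  finally show ?thesis .
qed

definition laplacian :: "(int ^ 'd \<Rightarrow> real) \<Rightarrow> (int ^ 'd::finite \<Rightarrow> real)" where
  "laplacian u = - (\<Sum>i\<in>UNIV. diff_adj i (diff_op i u))"

definition grad_norm :: "(int ^ 'd::finite \<Rightarrow> real) \<Rightarrow> real" where
  "grad_norm u = sqrt (\<Sum>i\<in>UNIV. (l2_norm (diff_op i u))\<^sup>2)"

text \<open>
  The norm \<open>\<parallel>\<D>\<^sup>n u\<parallel>\<close>, where \<open>\<D>\<^sup>n\<close> is \<open>\<Delta>\<^bsup>n/2\<^esup>\<close> for even \<open>n\<close> and
  \<open>\<nabla> \<Delta>\<^bsup>(n-1)/2\<^esup>\<close> for odd \<open>n\<close>.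
\<close>

definition Dn_norm :: "nat \<Rightarrow> (int ^ 'd::finite \<Rightarrow> real) \<Rightarrow> real" where
  "Dn_norm n u =
     (if even n then l2_norm ((laplacian ^^ (n div 2)) u)
      else grad_norm ((laplacian ^^ ((n - 1) div 2)) u))"


section \<open>The sharp constant\<close>

text \<open>
  The dimension enters through the index type of \<open>d\<close>, which is passed as \<open>TYPE('d)\<close>.
  The infimum is taken in \<^typ>\<open>ennreal\<close>, so it is \<open>\<infinity>\<close> if no constant is admissible.
  \<open>0 powr 0 = 0\<close> is harmless here: for \<open>\<theta> \<le> 1\<close> and \<open>n \<ge> 1\<close> it can only occur where
  \<open>u = 0\<close>, since \<open>u \<mapsto> \<parallel>\<D>\<^sup>n u\<parallel>\<close> vanishes on \<open>l\<^sup>2\<close> only at \<open>0\<close>.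
\<close>

definition interp_admissible :: "'d::finite itself \<Rightarrow> nat \<Rightarrow> real \<Rightarrow> real \<Rightarrow> bool" where
  "interp_admissible d n \<theta> C \<longleftrightarrow> 0 \<le> C \<and>
     (\<forall>u :: int ^ 'd \<Rightarrow> real. u \<in> l2 \<longrightarrow>
        (SUP k. (u k)\<^sup>2) \<le> C * l2_norm u powr (2 * \<theta>) * Dn_norm n u powr (2 * (1 - \<theta>)))"

definition sharp_const :: "'d::finite itself \<Rightarrow> nat \<Rightarrow> real \<Rightarrow> ennreal" where
  "sharp_const d n \<theta> = Inf (ennreal ` {C. interp_admissible d n \<theta> C})"


section \<open>Spectrum of an operator on \<open>l\<^sup>2\<close>\<close>

text \<open>
  The Hilbert space is real. For a bounded self-adjoint operator the spectrum of the
  complexification is real and agrees with the set below, and so do the multiplicities.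
\<close>

definition resolvent_set :: "(('a \<Rightarrow> real) \<Rightarrow> ('a \<Rightarrow> real)) \<Rightarrow> real set" where
  "resolvent_set T = {\<mu>. bij_betw (\<lambda>u. T u - \<mu> *\<^sub>R u) l2 l2 \<and>
     (\<exists>C. \<forall>u\<in>l2. l2_norm u \<le> C * l2_norm (T u - \<mu> *\<^sub>R u))}"

definition spectrum :: "(('a \<Rightarrow> real) \<Rightarrow> ('a \<Rightarrow> real)) \<Rightarrow> real set" where
  "spectrum T = - resolvent_set T"

definition eigenspace :: "(('a \<Rightarrow> real) \<Rightarrow> ('a \<Rightarrow> real)) \<Rightarrow> real \<Rightarrow> ('a \<Rightarrow> real) set" where
  "eigenspace T \<mu> = {u \<in> l2. T u = \<mu> *\<^sub>R u}"

definition eigenvalues :: "(('a \<Rightarrow> real) \<Rightarrow> ('a \<Rightarrow> real)) \<Rightarrow> real set" where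
  "eigenvalues T = {\<mu>. \<exists>u \<in> eigenspace T \<mu>. u \<noteq> 0}"

text \<open>
  Discreteness in the sense of operator theory: isolated points of the spectrum that are
  eigenvalues of finite multiplicity. Finiteness is stated separately because \<^const>\<open>dim\<close>
  is \<open>0\<close> on infinite-dimensional spaces.
\<close>

definition discrete_negative_spectrum :: "(('a \<Rightarrow> real) \<Rightarrow> ('a \<Rightarrow> real)) \<Rightarrow> bool" where
  "discrete_negative_spectrum T \<longleftrightarrow>
     (\<forall>\<mu> \<in> spectrum T. \<mu> < 0 \<longrightarrow>
        \<mu> isolated_in spectrum T \<and> \<mu> \<in> eigenvalues T \<and>
        (\<exists>B. finite B \<and> eigenspace T \<mu> \<subseteq> span B))"

definition negative_eigenvalue_sum :: "(('a \<Rightarrow> real) \<Rightarrow> ('a \<Rightarrow> real)) \<Rightarrow> ennreal" where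
  "negative_eigenvalue_sum T =
     (\<Sum>\<^sub>\<infinity>\<mu> \<in> {\<mu> \<in> eigenvalues T. \<mu> < 0}. of_nat (dim (eigenspace T \<mu>)) * ennreal \<bar>\<mu>\<bar>)"

definition schroedinger ::
  "nat \<Rightarrow> (int ^ 'd \<Rightarrow> real) \<Rightarrow> (int ^ 'd \<Rightarrow> real) \<Rightarrow> (int ^ 'd::finite \<Rightarrow> real)" where
  "schroedinger n V u = (\<lambda>k. (-1) ^ n * (laplacian ^^ n) u k - V k * u k)"

definition lattice_norm :: "int ^ 'd::finite \<Rightarrow> real" where
  "lattice_norm k = norm (\<chi> i. real_of_int (k $ i))"

end

theory Submission
  imports Defs
begin

text \<open>
  Fix an admissible constant \<open>C\<close> of the interpolation inequality. For an orthonormal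
  system \<open>E\<close> with density \<open>\<rho>(k) = \<Sum>x\<in>E. x(k)\<^sup>2\<close>, the inequality applied to the
  combination \<open>\<Sum>x\<in>E. x(k) x\<close> gives \<open>\<rho>(k)\<^bsup>2-\<theta>\<^esup> \<le> C q(k)\<^bsup>1-\<theta>\<^esup>\<close>, where the energies
  \<open>q(k)\<close> add up to the kinetic energy of \<open>E\<close>. Young's inequality bounds \<open>V \<rho> - q\<close>
  pointwise, and taking for \<open>E\<close> an orthonormal system of eigenvectors gives the estimate.
  The negative spectrum is discrete because, for every \<open>\<epsilon> > 0\<close>, the quadratic form of the
  operator is bounded below by \<open>-\<epsilon>\<close> on the sequences vanishing on the finite set where
  \<open>V \<ge> \<epsilon>\<close>.
\<close>

section \<open>The Hilbert space of square summable families\<close>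

text \<open>A type for \<open>l2\<close> turns it into a \<open>complete_space\<close>, so the
  contraction principle applies to it. The form bound plays the part of the statement that the
  essential spectrum lies above \<open>c\<close>. Below \<open>c\<close> it yields a count of
  eigenvalues and a Fredholm alternative: injectivity of T - \<mu> gives a lower bound by
  compactness, and the lower bound gives surjectivity by self-adjointness. In the trace estimate,
  the combination attached to k is the orthogonal projection onto the span of \<open>E\<close> of
  the unit vector at k. Its coordinate at k and its squared norm are both \<rho>(k), so a power of
  \<rho>(k) cancels in the interpolation inequality, and the energies q(k) are the diagonal entries
  of the kinetic operator compressed to that span. The last obstacle is that the sharp constant is
  an infimum in \<open>ennreal\<close>, possibly infinite, where 0 times infinity is 0; the
  potential sums 0 and infinity therefore need arguments of their own.\<close>

typedef 'a ell2 = "l2 :: ('a \<Rightarrow> real) set"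
  morphisms coord Abs_ell2
  by (rule exI[of _ "\<lambda>_. 0"]) (simp add: l2_def)

lemma l2_scaleR: "u \<in> l2 \<Longrightarrow> c *\<^sub>R u \<in> l2"
  by (auto simp: l2_def scaleR_fun_def power_mult_distrib intro: summable_on_cmult_right)

lemma l2_add:
  assumes "u \<in> l2" "v \<in> l2"
  shows "u + v \<in> l2"
proof -
  have "(u k + v k)\<^sup>2 = (u k)\<^sup>2 + 2 * (u k * v k) + (v k)\<^sup>2" for k
    by (simp add: power2_sum algebra_simps)
  moreover have "(\<lambda>k. (u k)\<^sup>2 + 2 * (u k * v k) + (v k)\<^sup>2) summable_on UNIV"
    using assms l2_mult_summable[OF assms] unfolding l2_def
    by (intro summable_on_add summable_on_cmult_right) auto
  ultimately show ?thesis
    by (simp add: l2_def)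
qed

lemma l2_uminus: "u \<in> l2 \<Longrightarrow> - u \<in> l2"
  by (simp add: l2_def)

lemma l2_minus: "u \<in> l2 \<Longrightarrow> v \<in> l2 \<Longrightarrow> u - v \<in> l2"
  using l2_add[of u "- v"] l2_uminus[of v] by simp

lemma l2_zero: "0 \<in> l2"
  by (simp add: l2_def)

lemma fun_sum_apply: "(sum f I) k = (\<Sum>i\<in>I. f i k)"
  for f :: "'i \<Rightarrow> 'k \<Rightarrow> real"
  by (induction I rule: infinite_finite_induct) auto

instantiation ell2 :: (type) real_vector
begin

definition zero_ell2 :: "'a ell2" where "0 = Abs_ell2 0"
definition plus_ell2 :: "'a ell2 \<Rightarrow> 'a ell2 \<Rightarrow> 'a ell2" where
  "x + y = Abs_ell2 (coord x + coord y)"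
definition minus_ell2 :: "'a ell2 \<Rightarrow> 'a ell2 \<Rightarrow> 'a ell2" where
  "x - y = Abs_ell2 (coord x - coord y)"
definition uminus_ell2 :: "'a ell2 \<Rightarrow> 'a ell2" where
  "- x = Abs_ell2 (- coord x)"
definition scaleR_ell2 :: "real \<Rightarrow> 'a ell2 \<Rightarrow> 'a ell2" where
  "c *\<^sub>R x = Abs_ell2 (c *\<^sub>R coord x)"

lemma coord_ell2_ops:
  shows "coord (0 :: 'a ell2) = 0"
    and "coord (x + y) = coord x + coord (y :: 'a ell2)"
    and "coord (x - y) = coord x - coord (y :: 'a ell2)"
    and "coord (- x) = - coord (x :: 'a ell2)"
    and "coord (c *\<^sub>R x) = c *\<^sub>R coord (x :: 'a ell2)"
  by (simp_all add: zero_ell2_def plus_ell2_def minus_ell2_def uminus_ell2_def scaleR_ell2_def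
      Abs_ell2_inverse l2_zero l2_add l2_minus l2_uminus l2_scaleR coord)

instance
  by standard (simp_all add: coord_inject[symmetric] coord_ell2_ops algebra_simps)

end

lemma coord_zero [simp]: "coord 0 k = 0"
  and coord_plus [simp]: "coord (x + y) k = coord x k + coord y k"
  and coord_minus [simp]: "coord (x - y) k = coord x k - coord y k"
  and coord_uminus [simp]: "coord (- x) k = - coord x k"
  and coord_scaleR [simp]: "coord (c *\<^sub>R x) k = c * coord x k"
  by (simp_all add: coord_ell2_ops scaleR_fun_def)

lemma coord_mult_summable: "(\<lambda>k. coord x k * coord y k) summable_on UNIV"
  by (intro l2_mult_summable coord)

instantiation ell2 :: (type) real_inner
begin

definition inner_ell2_def: "inner x (y :: 'a ell2) = (\<Sum>\<^sub>\<infinity>k. coord x k * coord y k)"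
definition norm_ell2_def: "norm (x :: 'a ell2) = sqrt (inner x x)"
definition dist_ell2_def: "dist x (y :: 'a ell2) = norm (x - y)"
definition sgn_ell2_def: "sgn (x :: 'a ell2) = x /\<^sub>R norm x"
definition uniformity_ell2_def:
  "(uniformity :: ('a ell2 \<times> 'a ell2) filter) = (INF e\<in>{0<..}. principal {(x, y). dist x y < e})"
definition open_ell2_def:
  "open (U :: 'a ell2 set) \<longleftrightarrow> (\<forall>x\<in>U. \<forall>\<^sub>F (x', y) in uniformity. x' = x \<longrightarrow> y \<in> U)"

instance
proof
  fix x y z :: "'a ell2" and a :: real
  show "dist x y = norm (x - y)" "sgn x = x /\<^sub>R norm x"
    "(uniformity :: ('a ell2 \<times> 'a ell2) filter) = (INF e\<in>{0<..}. principal {(x, y). dist x y < e})"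
    "norm x = sqrt (inner x x)"
    by (simp_all only: dist_ell2_def sgn_ell2_def uniformity_ell2_def norm_ell2_def)
  show "open U \<longleftrightarrow> (\<forall>x\<in>U. \<forall>\<^sub>F (x', y) in uniformity. x' = x \<longrightarrow> y \<in> U)" for U :: "'a ell2 set"
    by (simp only: open_ell2_def)
  show "inner x y = inner y x"
    by (simp add: inner_ell2_def mult.commute)
  show "inner (x + y) z = inner x z + inner y z"
    by (simp add: inner_ell2_def distrib_right infsum_add coord_mult_summable)
  show "inner (a *\<^sub>R x) y = a * inner x y"
    by (simp add: inner_ell2_def mult.assoc infsum_cmult_right')
  show "0 \<le> inner x x"
    by (simp add: inner_ell2_def infsum_nonneg)
  show "inner x x = 0 \<longleftrightarrow> x = 0"
  proof
    assume "inner x x = 0"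
    then have "coord x k * coord x k = 0" for k
      using nonneg_infsum_le_0D[of "\<lambda>k. coord x k * coord x k" UNIV k]
      by (simp add: inner_ell2_def coord_mult_summable)
    then show "x = 0"
      by (simp add: coord_inject[symmetric] fun_eq_iff)
  qed (simp add: inner_ell2_def)
qed

end

section \<open>Coordinates, norms and completeness\<close>

lemma coord_sum [simp]: "coord (sum f I) k = (\<Sum>i\<in>I. coord (f i) k)"
  by (induction I rule: infinite_finite_induct) auto

lemma linear_coord: "linear coord"
  by (rule linearI) (simp_all add: coord_ell2_ops)

lemma has_sum_inner_ell2: "((\<lambda>k. coord x k * coord y k) has_sum inner x y) UNIV"
  by (simp add: inner_ell2_def coord_mult_summable)

lemma norm_ell2_eq_l2_norm: "norm x = l2_norm (coord x)"
  by (simp add: norm_ell2_def inner_ell2_def l2_norm_def power2_eq_square)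

lemma has_sum_norm_ell2: "((\<lambda>k. (coord x k)\<^sup>2) has_sum (norm x)\<^sup>2) UNIV"
  using has_sum_inner_ell2[of x x]
  by (simp only: power2_norm_eq_inner power2_eq_square[of "coord x _"])

lemma sum_coord_le_norm:
  assumes "finite S"
  shows "(\<Sum>k\<in>S. (coord x k)\<^sup>2) \<le> (norm x)\<^sup>2"
  by (rule finite_sum_le_has_sum[OF has_sum_norm_ell2]) (use assms in auto)

lemma coord_square_le_norm: "(coord x k)\<^sup>2 \<le> (norm x)\<^sup>2"
  using sum_coord_le_norm[of "{k}" x] by simp

lemma abs_coord_le_norm: "\<bar>coord x k\<bar> \<le> norm x"
  using coord_square_le_norm[of x k] by (simp add: abs_le_square_iff[symmetric])

lemma bounded_linear_coord: "bounded_linear (\<lambda>x. coord x k)"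
  by (rule bounded_linear_intro[where K = 1]) (simp_all add: abs_coord_le_norm)

text \<open>Bounds on finite partial sums survive coordinatewise limits and pointwise estimates;
  this serves both completeness and multiplication operators.\<close>

lemma ell2_bounded_partial_sums:
  assumes "\<And>S. finite S \<Longrightarrow> (\<Sum>k\<in>S. (u k)\<^sup>2) \<le> B"
  shows "u \<in> l2" and "norm (Abs_ell2 u) \<le> sqrt B"
proof -
  show u: "u \<in> l2"
    unfolding l2_def mem_Collect_eq
    by (rule nonneg_bounded_partial_sums_imp_summable_on[where C = B])
      (use assms in \<open>auto intro: eventually_finite_subsets_at_top_weakI\<close>)
  then have "(\<Sum>\<^sub>\<infinity>k. (u k)\<^sup>2) \<le> B"
    using assms by (auto simp: l2_def intro: infsum_le_finite_sums)
  then show "norm (Abs_ell2 u) \<le> sqrt B"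
    using u by (simp add: norm_ell2_eq_l2_norm l2_norm_def Abs_ell2_inverse)
qed

text \<open>Coordinatewise limits exist because the reals are complete. The Cauchy estimate,
  restricted to finitely many coordinates, passes to the limit with a bound independent of the
  finite set.\<close>

instance ell2 :: (type) complete_space
proof
  fix X :: "nat \<Rightarrow> 'a ell2"
  assume X: "Cauchy X"
  have "Cauchy (\<lambda>n. coord (X n) k)" for k
    using bounded_linear.Cauchy[OF bounded_linear_coord X] .
  then obtain u where u: "\<And>k. (\<lambda>n. coord (X n) k) \<longlonglongrightarrow> u k"
    unfolding Cauchy_convergent_iff convergent_def by metis
  \<comment> \<open>Membership comes with the estimate because \<open>Abs_ell2\<close> is meaningful
    only on \<open>l2\<close>. The strict bound becomes non-strict in the limit, hence
    \<open>r / 2\<close> below.\<close>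
  have close: "(\<lambda>k. coord (X n) k - u k) \<in> l2 \<and> norm (Abs_ell2 (\<lambda>k. coord (X n) k - u k)) \<le> e"
    if N: "\<forall>m\<ge>N. \<forall>n\<ge>N. norm (X m - X n) < e" and "n \<ge> N" for N n e
  proof -
    have e: "e > 0"
      using N \<open>n \<ge> N\<close> by (metis norm_ge_zero order.strict_trans1)
    have "(\<Sum>k\<in>S. (coord (X n) k - u k)\<^sup>2) \<le> e\<^sup>2" if "finite S" for S
    proof (rule LIMSEQ_le_const2)
      show "(\<lambda>m. \<Sum>k\<in>S. (coord (X n) k - coord (X m) k)\<^sup>2) \<longlonglongrightarrow> (\<Sum>k\<in>S. (coord (X n) k - u k)\<^sup>2)"
        by (intro tendsto_intros u)
      have "(\<Sum>k\<in>S. (coord (X n) k - coord (X m) k)\<^sup>2) \<le> e\<^sup>2" if "m \<ge> N" for m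
      proof -
        have "(\<Sum>k\<in>S. (coord (X n - X m) k)\<^sup>2) \<le> (norm (X n - X m))\<^sup>2"
          by (rule sum_coord_le_norm) fact
        also have "\<dots> \<le> e\<^sup>2"
          using N that \<open>n \<ge> N\<close> by (intro power_mono) (auto intro: less_imp_le)
        finally show ?thesis
          by simp
      qed
      then show "\<exists>N. \<forall>m\<ge>N. (\<Sum>k\<in>S. (coord (X n) k - coord (X m) k)\<^sup>2) \<le> e\<^sup>2"
        by blast
    qed
    from ell2_bounded_partial_sums[OF this] show ?thesis
      using e by simp
  qed
  obtain N0 where "\<forall>m\<ge>N0. \<forall>n\<ge>N0. norm (X m - X n) < 1"
    using CauchyD[OF X, of 1] by auto
  then have "(\<lambda>k. coord (X N0) k - u k) \<in> l2"
    using close by blast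
  from l2_minus[OF coord[of "X N0"] this] have ul: "u \<in> l2"
    by (simp add: fun_diff_def)
  have "X \<longlonglongrightarrow> Abs_ell2 u"
    unfolding lim_sequentially dist_norm
  proof (intro allI impI)
    fix r :: real
    assume "0 < r"
    then obtain N where N: "\<forall>m\<ge>N. \<forall>n\<ge>N. norm (X m - X n) < r / 2"
      using CauchyD[OF X, of "r / 2"] by auto
    have "norm (X n - Abs_ell2 u) < r" if "n \<ge> N" for n
    proof -
      have "X n - Abs_ell2 u = Abs_ell2 (\<lambda>k. coord (X n) k - u k)"
        by (simp add: minus_ell2_def Abs_ell2_inverse ul fun_diff_def)
      then show ?thesis
        using close[OF N that] \<open>0 < r\<close> by simp
    qed
    then show "\<exists>N. \<forall>n\<ge>N. norm (X n - Abs_ell2 u) < r"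
      by blast
  qed
  then show "convergent X"
    by (auto simp: convergent_def)
qed


section \<open>Self-adjoint operators that are bounded below off a finite-dimensional space\<close>

text \<open>
  The square of an operator that is bounded below is coercive, so \<open>T\<^sup>2 x = y\<close> is solved by
  the contraction \<open>x \<mapsto> x - \<tau> (T\<^sup>2 x - y)\<close>, without orthogonal projections.
\<close>

lemma selfadjoint_bounded_below_surj:
  fixes T :: "'h::{real_inner,complete_space} \<Rightarrow> 'h"
  assumes T: "bounded_linear T"
    and sym: "\<And>x y. inner (T x) y = inner x (T y)"
    and below: "\<And>x. norm x \<le> C * norm (T x)"
  shows "surj T"
proof -
  interpret T: bounded_linear T by fact
  obtain M where M: "M > 0" "\<And>x. norm (T x) \<le> norm x * M"
    using T.pos_bounded by blast
  \<comment> \<open>Enlarging \<open>C\<close> ensures \<open>D > 0\<close> and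
    \<open>D * M \<ge> 1\<close>, which keeps the contraction factor in [0,1). It makes a difference
    only on the trivial space, where \<open>C\<close> may be anything.\<close>
  define D where "D = max C (1 / M)"
  have "1 / M \<le> D"
    by (simp add: D_def)
  moreover have "1 / M > 0"
    using M(1) by simp
  ultimately have D: "D > 0" "D * M \<ge> 1"
    using M(1) by (linarith, simp add: pos_divide_le_eq)
  have belowD: "norm x \<le> D * norm (T x)" for x
  proof -
    have "C * norm (T x) \<le> D * norm (T x)"
      by (intro mult_right_mono) (auto simp: D_def)
    then show ?thesis
      using below[of x] by linarith
  qed
  \<comment> \<open>The minimiser of \<open>1 - 2 * \<tau> / D^2 + \<tau>^2 * M^4\<close>, the bound
    on the squared contraction factor; the minimum is \<open>1 - 1 / (D * M)^4\<close>.\<close>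
  define \<tau> where "\<tau> = 1 / (D ^ 2 * M ^ 4)"
  have contr: "norm (x - \<tau> *\<^sub>R T (T x)) \<le> sqrt (1 - 1 / (D * M) ^ 4) * norm x" for x
  proof -
    have "norm (T (T x)) \<le> norm x * M * M"
      using M(2)[of "T x"] M(2)[of x] M(1) by (meson mult_right_mono less_imp_le order_trans)
    then have "(norm (T (T x)))\<^sup>2 \<le> (norm x * M * M)\<^sup>2"
      by (intro power_mono) auto
    then have up: "(norm (T (T x)))\<^sup>2 \<le> (norm x)\<^sup>2 * M ^ 4"
      by (simp add: power_mult_distrib algebra_simps power2_eq_square power4_eq_xxxx)
    have "(norm x)\<^sup>2 \<le> (D * norm (T x))\<^sup>2"
      by (intro power_mono belowD) auto
    then have low: "(norm x)\<^sup>2 / D\<^sup>2 \<le> (norm (T x))\<^sup>2"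
      using D by (simp add: field_simps power_mult_distrib)
    have "(norm (x - \<tau> *\<^sub>R T (T x)))\<^sup>2
        = (norm x)\<^sup>2 - 2 * \<tau> * (norm (T x))\<^sup>2 + \<tau>\<^sup>2 * (norm (T (T x)))\<^sup>2"
      using sym[of x "T x"] unfolding power2_norm_eq_inner power2_eq_square[of \<tau>]
      by (simp add: inner_diff_left inner_diff_right inner_commute algebra_simps)
    also have "\<dots> \<le> (norm x)\<^sup>2 - 2 * \<tau> * ((norm x)\<^sup>2 / D\<^sup>2) + \<tau>\<^sup>2 * ((norm x)\<^sup>2 * M ^ 4)"
      using up low D(1) M(1) by (intro add_mono diff_mono mult_left_mono) (auto simp: \<tau>_def)
    also have "\<dots> = (1 - 1 / (D * M) ^ 4) * (norm x)\<^sup>2"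
      using D(1) M(1) by (simp add: \<tau>_def field_simps power2_eq_square power4_eq_xxxx)
    finally have "sqrt ((norm (x - \<tau> *\<^sub>R T (T x)))\<^sup>2) \<le> sqrt ((1 - 1 / (D * M) ^ 4) * (norm x)\<^sup>2)"
      by (rule real_sqrt_le_mono)
    then show ?thesis
      by (simp add: real_sqrt_mult)
  qed
  have "\<exists>x. T (T x) = y" for y
  proof -
    define f where "f x = x - \<tau> *\<^sub>R (T (T x) - y)" for x
    have "\<exists>!x. f x = x"
    proof (rule banach_fix_type)
      have "(D * M) ^ 4 \<ge> 1"
        using D(2) by (rule one_le_power)
      then show "0 \<le> sqrt (1 - 1 / (D * M) ^ 4)" "sqrt (1 - 1 / (D * M) ^ 4) < 1"
        by (auto simp: field_simps)
      have "f x - f z = (x - z) - \<tau> *\<^sub>R T (T (x - z))" for x z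
        by (simp add: f_def T.diff algebra_simps)
      then show "\<forall>x z. dist (f x) (f z) \<le> sqrt (1 - 1 / (D * M) ^ 4) * dist x z"
        using contr by (simp add: dist_norm)
    qed
    then obtain x where "f x = x"
      by blast
    then have "\<tau> *\<^sub>R (T (T x) - y) = 0"
      by (simp add: f_def)
    then show ?thesis
      using D(1) M(1) by (auto simp: \<tau>_def)
  qed
  then show ?thesis
    unfolding surj_def by metis
qed


text \<open>On the common kernel of finitely many functionals the form is at least \<open>c\<close>.
  In the application these are the coordinates at the sites where the potential is large. The sign
  of \<open>M\<close> is left open.\<close>

locale form_bounded_below =
  fixes T :: "'h::{real_inner,complete_space} \<Rightarrow> 'h"
    and F :: "'k set" and \<phi> :: "'k \<Rightarrow> 'h \<Rightarrow> real" and c M :: real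
  assumes T: "bounded_linear T"
    and sym: "\<And>x y. inner (T x) y = inner x (T y)"
    and finite_F: "finite F"
    and phi: "\<And>k. k \<in> F \<Longrightarrow> bounded_linear (\<phi> k)"
    and form: "\<And>x. inner (T x) x \<ge> c * (norm x)\<^sup>2 - M * (\<Sum>k\<in>F. (\<phi> k x)\<^sup>2)"
begin

sublocale T: bounded_linear T
  by (rule T)

text \<open>The counting half of the min-max principle: a vector of \<open>span E\<close> killed by
  all the functionals would violate \<open>neg\<close> unless it is 0, so the functionals embed
  \<open>span E\<close> into a space of dimension at most \<open>card F\<close>.\<close>

lemma independent_card_le:
  assumes "independent E"
    and neg: "\<And>x. x \<in> span E \<Longrightarrow> x \<noteq> 0 \<Longrightarrow> inner (T x) x < c * (norm x)\<^sup>2"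
  shows "finite E \<and> card E \<le> card F"
proof -
  \<comment> \<open>Extension by zero outside \<open>F\<close> places the images in the span of the
    indicators \<open>b k\<close>, k in \<open>F\<close>.\<close>
  define f where "f x = (\<lambda>k. if k \<in> F then \<phi> k x else 0)" for x
  have lin: "linear f"
    using phi by (intro linearI) (auto simp: f_def fun_eq_iff scaleR_fun_def
        linear_add[OF bounded_linear.linear] linear_scale[OF bounded_linear.linear])
  have "inj_on f (span E)"
    unfolding linear_inj_on_iff_eq_0[OF lin subspace_span]
  proof (intro ballI impI)
    fix x
    assume x: "x \<in> span E" "f x = 0"
    then have "\<phi> k x = 0" if "k \<in> F" for k
      using that by (auto simp: f_def fun_eq_iff split: if_splits)
    then have "inner (T x) x \<ge> c * (norm x)\<^sup>2"
      using form[of x] by simp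
    with neg[OF x(1)] show "x = 0"
      by force
  qed
  with \<open>independent E\<close> have ind: "independent (f ` E)"
    using linear_independent_injective_image[OF lin] by blast
  define b where "b k = (\<lambda>j. if j = k then 1 else 0 :: real)" for k :: 'k
  have "f x = (\<Sum>k\<in>F. \<phi> k x *\<^sub>R b k)" for x
  proof
    show "f x j = (\<Sum>k\<in>F. \<phi> k x *\<^sub>R b k) j" for j
      using finite_F by (simp add: f_def b_def scaleR_fun_def fun_sum_apply if_distrib cong: if_cong)
  qed
  moreover have "(\<Sum>k\<in>F. \<phi> k x *\<^sub>R b k) \<in> span (b ` F)" for x
    by (intro span_sum span_scale span_base imageI)
  ultimately have "f ` E \<subseteq> span (b ` F)"
    by (simp add: image_subset_iff)
  with independent_span_bound[OF _ ind, of "b ` F"] finite_F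
  have "finite (f ` E)" "card (f ` E) \<le> card (b ` F)"
    by auto
  moreover have "inj_on f E"
    using \<open>inj_on f (span E)\<close> by (meson inj_on_subset span_superset)
  ultimately show ?thesis
    using card_image_le[OF finite_F, of b] by (auto simp: card_image dest: finite_imageD)
qed

text \<open>On an eigenspace the form is \<mu> times the squared norm, so the count applies to any
  independent subset. A maximal one is then a finite basis.\<close>

lemma eigenvectors_finite_span:
  assumes "\<mu> < c"
  obtains B where "finite B" "independent B" "B \<subseteq> {x. T x = \<mu> *\<^sub>R x}" "{x. T x = \<mu> *\<^sub>R x} = span B"
proof -
  let ?V = "{x. T x = \<mu> *\<^sub>R x}"
  have sub: "subspace ?V"
    by (rule subspaceI) (auto simp: T.add T.scale algebra_simps T.zero)
  obtain B where B: "B \<subseteq> ?V" "independent B" "?V \<subseteq> span B"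
    by (rule maximal_independent_subset)
  have span: "span B \<subseteq> ?V"
    using B(1) sub by (rule span_minimal)
  have "finite B \<and> card B \<le> card F"
  proof (rule independent_card_le[OF B(2)])
    fix x assume x: "x \<in> span B" "x \<noteq> 0"
    then have "T x = \<mu> *\<^sub>R x"
      using span by blast
    then show "inner (T x) x < c * (norm x)\<^sup>2"
      using x(2) assms by (simp add: power2_norm_eq_inner)
  qed
  with B span that[of B] show thesis
    by blast
qed

lemma eigenvectors_orthogonal:
  assumes "T x = \<mu> *\<^sub>R x" "T y = \<nu> *\<^sub>R y" "\<mu> \<noteq> \<nu>"
  shows "orthogonal x y"
  using sym[of x y] assms by (simp add: orthogonal_def)

text \<open>One eigenvector per eigenvalue gives an orthogonal family on whose span the form is
  diagonal with entries below \<open>c\<close>, so the count applies. This is what makes the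
  spectrum below \<open>c\<close> isolated.\<close>

lemma finite_eigenvalues: "finite {\<mu>. \<mu> < c \<and> (\<exists>x. x \<noteq> 0 \<and> T x = \<mu> *\<^sub>R x)}"
proof -
  define \<Lambda> where "\<Lambda> = {\<mu>. \<mu> < c \<and> (\<exists>x. x \<noteq> 0 \<and> T x = \<mu> *\<^sub>R x)}"
  define e where "e \<mu> = (SOME x. x \<noteq> 0 \<and> T x = \<mu> *\<^sub>R x)" for \<mu>
  have "e \<mu> \<noteq> 0 \<and> T (e \<mu>) = \<mu> *\<^sub>R e \<mu>" if "\<mu> \<in> \<Lambda>" for \<mu>
    unfolding e_def by (rule someI_ex) (use that in \<open>simp add: \<Lambda>_def\<close>)
  then have e0: "e \<mu> \<noteq> 0" and Te: "T (e \<mu>) = \<mu> *\<^sub>R e \<mu>" and less: "\<mu> < c" if "\<mu> \<in> \<Lambda>" for \<mu>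
    using that by (simp_all add: \<Lambda>_def)
  have orth: "inner (e \<mu>) (e \<nu>) = 0" if "\<mu> \<in> \<Lambda>" "\<nu> \<in> \<Lambda>" "\<mu> \<noteq> \<nu>" for \<mu> \<nu>
    using eigenvectors_orthogonal[OF Te Te] that by (simp add: orthogonal_def)
  have inj: "inj_on e \<Lambda>"
  proof (rule inj_onI, rule ccontr)
    fix \<mu> \<nu> assume "\<mu> \<in> \<Lambda>" "\<nu> \<in> \<Lambda>" "e \<mu> = e \<nu>" "\<mu> \<noteq> \<nu>"
    then show False
      using orth[of \<mu> \<nu>] e0[of \<mu>] by simp
  qed
  have "pairwise orthogonal (e ` \<Lambda>)"
    using orth unfolding pairwise_image pairwise_def orthogonal_def by blast
  moreover have "0 \<notin> e ` \<Lambda>"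
    using e0 by fastforce
  ultimately have "independent (e ` \<Lambda>)"
    by (rule pairwise_orthogonal_independent)
  then have "finite (e ` \<Lambda>) \<and> card (e ` \<Lambda>) \<le> card F"
  proof (rule independent_card_le)
    fix x assume "x \<in> span (e ` \<Lambda>)" and x0: "x \<noteq> 0"
    then obtain S r where S: "finite S" "S \<subseteq> e ` \<Lambda>" and x: "x = (\<Sum>v\<in>S. r v *\<^sub>R v)"
      by (auto simp: span_explicit)
    obtain L where L: "L \<subseteq> \<Lambda>" "S = e ` L" "finite L"
      using S by (metis finite_subset_image)
    have x: "x = (\<Sum>\<mu>\<in>L. r (e \<mu>) *\<^sub>R e \<mu>)"
      unfolding x L(2) using inj_on_subset[OF inj L(1)] by (simp add: sum.reindex)
    have Tx: "T x = (\<Sum>\<mu>\<in>L. (r (e \<mu>) * \<mu>) *\<^sub>R e \<mu>)"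
      unfolding x T.sum T.scale using L(1) by (intro sum.cong) (auto simp: Te)
    \<comment> \<open>\<open>w \<mu>\<close> is the squared length of the component of
      \<open>x\<close> along \<open>e \<mu>\<close>. The identity \<open>diag\<close> serves twice:
      constant weight 1 gives the norm, weight \<mu> gives the form.\<close>
    define w where "w \<mu> = (r (e \<mu>))\<^sup>2 * (norm (e \<mu>))\<^sup>2" for \<mu>
    have diag: "inner (\<Sum>\<mu>\<in>L. (r (e \<mu>) * a \<mu>) *\<^sub>R e \<mu>) x = (\<Sum>\<mu>\<in>L. a \<mu> * w \<mu>)" for a
    proof -
      have "inner (e \<mu>) x = r (e \<mu>) * (norm (e \<mu>))\<^sup>2" if "\<mu> \<in> L" for \<mu>
      proof -
        have "inner (e \<mu>) x = (\<Sum>\<nu>\<in>L. if \<nu> = \<mu> then r (e \<mu>) * (norm (e \<mu>))\<^sup>2 else 0)"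
          unfolding x inner_sum_right inner_scaleR_right
          using L(1) that orth by (intro sum.cong) (auto simp: power2_norm_eq_inner)
        then show ?thesis
          using that L(3) by simp
      qed
      then show ?thesis
        by (simp add: inner_sum_left w_def power2_eq_square mult_ac)
    qed
    have nx: "(norm x)\<^sup>2 = (\<Sum>\<mu>\<in>L. w \<mu>)"
      using diag[of "\<lambda>_. 1"] by (simp add: x[symmetric] power2_norm_eq_inner)
    have "inner (T x) x = (\<Sum>\<mu>\<in>L. \<mu> * w \<mu>)"
      unfolding Tx by (rule diag)
    also have "\<dots> < (\<Sum>\<mu>\<in>L. c * w \<mu>)"
    proof (rule sum_strict_mono_ex1[OF L(3)])
      show "\<forall>\<mu>\<in>L. \<mu> * w \<mu> \<le> c * w \<mu>"
      proof
        fix \<mu> assume "\<mu> \<in> L"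
        then show "\<mu> * w \<mu> \<le> c * w \<mu>"
          using L(1) less[of \<mu>] by (intro mult_right_mono) (auto simp: w_def)
      qed
      obtain \<mu> where mu: "\<mu> \<in> L" "r (e \<mu>) \<noteq> 0"
        using x0 unfolding x by (metis (no_types, lifting) scale_eq_0_iff sum.neutral)
      then have "\<mu> \<in> \<Lambda>"
        using L(1) by blast
      with mu have "\<mu> * w \<mu> < c * w \<mu>"
        using e0[of \<mu>] less[of \<mu>] by (intro mult_strict_right_mono) (simp_all add: w_def)
      with mu(1) show "\<exists>\<mu>\<in>L. \<mu> * w \<mu> < c * w \<mu>"
        by blast
    qed
    also have "\<dots> = c * (norm x)\<^sup>2"
      by (simp add: nx sum_distrib_left)
    finally show "inner (T x) x < c * (norm x)\<^sup>2" .
  qed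
  then show ?thesis
    using inj finite_imageD unfolding \<Lambda>_def by blast
qed

text \<open>
  The compactness argument: along a normalised sequence of approximate eigenvectors for
  \<open>\<mu> < c\<close> whose images under the finitely many functionals converge, the form bound
  makes the sequence Cauchy, and its limit is an eigenvector.
\<close>

lemma bounded_below_if_inj:
  assumes mu: "\<mu> < c" and inj: "\<And>x. T x = \<mu> *\<^sub>R x \<Longrightarrow> x = 0"
  shows "\<exists>C. \<forall>x. norm x \<le> C * norm (T x - \<mu> *\<^sub>R x)"
proof (rule ccontr)
  assume "\<not> ?thesis"
  then have "\<forall>n. \<exists>x. norm x > real (Suc n) * norm (T x - \<mu> *\<^sub>R x)"
    by (meson not_le)
  then obtain y where y: "\<And>n. norm (y n) > real (Suc n) * norm (T (y n) - \<mu> *\<^sub>R y n)"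
    by metis
  have y0: "norm (y n) > 0" for n
    using y[of n] by (smt (verit) mult_nonneg_nonneg norm_ge_zero of_nat_0_le_iff)
  define x where "x n = y n /\<^sub>R norm (y n)" for n
  have nx [simp]: "norm (x n) = 1" for n
    using y0[of n] by (simp add: x_def)
  define R where "R z = T z - \<mu> *\<^sub>R z" for z
  have lin_R: "bounded_linear R"
    unfolding R_def by (intro bounded_linear_sub T bounded_linear_scaleR_right)
  interpret R: bounded_linear R by (rule lin_R)
  have "norm (R (x n)) \<le> inverse (real (Suc n))" for n
  proof -
    have "norm (R (x n)) = norm (R (y n)) / norm (y n)"
      using y0[of n] by (simp add: x_def R.scale divide_inverse)
    also have "\<dots> \<le> (norm (y n) / real (Suc n)) / norm (y n)"
      using y[of n] by (intro divide_right_mono) (simp_all add: R_def field_simps)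
    finally show ?thesis
      using y0[of n] by (simp add: inverse_eq_divide)
  qed
  then have Rx: "(\<lambda>n. R (x n)) \<longlonglongrightarrow> 0"
    by (intro Lim_null_comparison[OF _ LIMSEQ_inverse_real_of_nat]) auto
  have "bounded ((\<lambda>f. f k) ` range (\<lambda>n k. \<phi> k (x n)))" if k: "k \<in> F" for k
  proof -
    obtain K where "\<And>z. norm (\<phi> k z) \<le> norm z * K"
      using bounded_linear.bounded[OF phi[OF k]] by blast
    from this[of "x _"] show ?thesis
      by (intro boundedI[of _ K]) auto
  qed
  \<comment> \<open>Bolzano-Weierstrass in finitely many coordinates: a single subsequence along
    which all functionals converge.\<close>
  then have "\<forall>d\<subseteq>F. \<exists>l r. strict_mono (r :: nat \<Rightarrow> nat)
      \<and> (\<forall>e>0. \<forall>\<^sub>F n in sequentially. \<forall>k\<in>d. dist (\<phi> k (x (r n))) (l k) < e)"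
    using compact_lemma_general[of F "\<lambda>f k. f k" "\<lambda>n k. \<phi> k (x n)" "\<lambda>f. f"] finite_F by auto
  from this[rule_format, OF order_refl] obtain l r where r: "strict_mono (r :: nat \<Rightarrow> nat)"
    and l: "\<And>e. e > 0 \<Longrightarrow> \<forall>\<^sub>F n in sequentially. \<forall>k\<in>F. dist (\<phi> k (x (r n))) (l k) < e"
    by blast
  define z where "z n = x (r n)" for n
  have nz [simp]: "norm (z n) = 1" for n
    by (simp add: z_def)
  have Rz: "(\<lambda>n. R (z n)) \<longlonglongrightarrow> 0"
    using LIMSEQ_subseq_LIMSEQ[OF Rx r] by (simp add: z_def o_def)
  have phi_z: "(\<lambda>n. \<phi> k (z n)) \<longlonglongrightarrow> l k" if "k \<in> F" for k
  proof (rule tendstoI)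
    fix e :: real assume "0 < e"
    from l[OF this] show "\<forall>\<^sub>F n in sequentially. dist (\<phi> k (z n)) (l k) < e"
      by (rule eventually_mono) (use that in \<open>simp add: z_def\<close>)
  qed
  \<comment> \<open>Chosen so that \<open>a m + a n\<close> dominates \<open>(c - \<mu>)\<close>
    times the squared distance of \<open>z m\<close> and \<open>z n\<close>. The first 2 bounds that
    distance in Cauchy-Schwarz, the second comes from splitting a squared difference.\<close>
  define a where "a n = 2 * norm (R (z n)) + \<bar>M\<bar> * (\<Sum>k\<in>F. 2 * (\<phi> k (z n) - l k)\<^sup>2)" for n
  have "a \<longlonglongrightarrow> 2 * norm (0 :: 'h) + \<bar>M\<bar> * (\<Sum>k\<in>F. 2 * (l k - l k)\<^sup>2)"
    unfolding a_def by (intro tendsto_intros Rz phi_z)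
  then have a: "a \<longlonglongrightarrow> 0"
    by simp
  have square_diff_le: "(p - q)\<^sup>2 \<le> 2 * p\<^sup>2 + 2 * q\<^sup>2" for p q :: real
    using zero_le_power2[of "p + q"] by (simp add: power2_sum power2_diff)
  have diff: "(c - \<mu>) * (norm (z m - z n))\<^sup>2 \<le> a m + a n" for m n
  proof -
    let ?w = "z m - z n"
    have "inner (R ?w) ?w \<le> norm (R ?w) * norm ?w"
      by (rule norm_cauchy_schwarz)
    also have "\<dots> \<le> (norm (R (z m)) + norm (R (z n))) * 2"
      using norm_triangle_ineq4[of "z m" "z n"] norm_triangle_ineq4[of "R (z m)" "R (z n)"]
      by (intro mult_mono) (auto simp: R.diff)
    finally have 1: "inner (R ?w) ?w \<le> 2 * norm (R (z m)) + 2 * norm (R (z n))"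
      by simp
    have "(\<phi> k ?w)\<^sup>2 \<le> 2 * (\<phi> k (z m) - l k)\<^sup>2 + 2 * (\<phi> k (z n) - l k)\<^sup>2" if "k \<in> F" for k
    proof -
      have "\<phi> k ?w = (\<phi> k (z m) - l k) - (\<phi> k (z n) - l k)"
        using linear_diff[OF bounded_linear.linear[OF phi[OF that]]] by simp
      then show ?thesis
        using square_diff_le[of "\<phi> k (z m) - l k" "\<phi> k (z n) - l k"] by simp
    qed
    then have "(\<Sum>k\<in>F. (\<phi> k ?w)\<^sup>2)
        \<le> (\<Sum>k\<in>F. 2 * (\<phi> k (z m) - l k)\<^sup>2) + (\<Sum>k\<in>F. 2 * (\<phi> k (z n) - l k)\<^sup>2)"
      unfolding sum.distrib[symmetric] by (rule sum_mono)
    then have "\<bar>M\<bar> * (\<Sum>k\<in>F. (\<phi> k ?w)\<^sup>2) \<le> \<bar>M\<bar> * ((\<Sum>k\<in>F. 2 * (\<phi> k (z m) - l k)\<^sup>2)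
        + (\<Sum>k\<in>F. 2 * (\<phi> k (z n) - l k)\<^sup>2))"
      by (intro mult_left_mono) auto
    moreover have "M * (\<Sum>k\<in>F. (\<phi> k ?w)\<^sup>2) \<le> \<bar>M\<bar> * (\<Sum>k\<in>F. (\<phi> k ?w)\<^sup>2)"
      by (intro mult_right_mono sum_nonneg) auto
    moreover have "inner (R ?w) ?w = inner (T ?w) ?w - \<mu> * (norm ?w)\<^sup>2"
      unfolding R_def by (simp add: inner_diff_left power2_norm_eq_inner)
    ultimately show ?thesis
      using form[of ?w] 1 by (simp add: a_def algebra_simps)
  qed
  have "Cauchy z"
  proof (rule metric_CauchyI)
    fix e :: real assume e: "0 < e"
    then have "0 < (c - \<mu>) * e\<^sup>2 / 2"
      using mu by simp
    then obtain N where N: "\<And>n. n \<ge> N \<Longrightarrow> norm (a n - 0) < (c - \<mu>) * e\<^sup>2 / 2"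
      using LIMSEQ_D[OF a] by blast
    have "dist (z m) (z n) < e" if "m \<ge> N" "n \<ge> N" for m n
    proof -
      have "(c - \<mu>) * (norm (z m - z n))\<^sup>2 < (c - \<mu>) * e\<^sup>2"
        using diff[of m n] N[OF that(1)] N[OF that(2)] by simp
      then have "(norm (z m - z n))\<^sup>2 < e\<^sup>2"
        using mu by simp
      then show ?thesis
        using e by (simp add: dist_norm power2_less_imp_less)
    qed
    then show "\<exists>N. \<forall>m\<ge>N. \<forall>n\<ge>N. dist (z m) (z n) < e"
      by blast
  qed
  then obtain w where w: "z \<longlonglongrightarrow> w"
    using Cauchy_convergent_iff convergent_def by blast
  \<comment> \<open>The limit is a unit eigenvector, which injectivity excludes.\<close>
  have "R w = 0"
    using LIMSEQ_unique[OF R.tendsto[OF w] Rz] .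
  then have "w = 0"
    using inj by (simp add: R_def)
  moreover have "norm w = 1"
    using LIMSEQ_unique[OF tendsto_norm[OF w]] by simp
  ultimately show False
    by simp
qed

text \<open>The Fredholm alternative below \<open>c\<close>: a real number there is either an
  eigenvalue or in the resolvent set.\<close>

lemma bij_bounded_below_if_inj:
  assumes mu: "\<mu> < c" and inj: "\<And>x. T x = \<mu> *\<^sub>R x \<Longrightarrow> x = 0"
  shows "bij (\<lambda>x. T x - \<mu> *\<^sub>R x) \<and> (\<exists>C. \<forall>x. norm x \<le> C * norm (T x - \<mu> *\<^sub>R x))"
proof -
  obtain C where C: "\<And>x. norm x \<le> C * norm (T x - \<mu> *\<^sub>R x)"
    using bounded_below_if_inj[OF assms] by blast
  have "surj (\<lambda>x. T x - \<mu> *\<^sub>R x)"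
    by (rule selfadjoint_bounded_below_surj[OF _ _ C])
      (simp_all add: bounded_linear_sub T bounded_linear_scaleR_right sym
        inner_diff_left inner_diff_right)
  moreover have "inj (\<lambda>x. T x - \<mu> *\<^sub>R x)"
  proof (rule injI)
    fix x y assume "T x - \<mu> *\<^sub>R x = T y - \<mu> *\<^sub>R y"
    then have "T (x - y) = \<mu> *\<^sub>R (x - y)"
      by (simp add: T.diff algebra_simps)
    from inj[OF this] show "x = y"
      by simp
  qed
  ultimately show ?thesis
    using C by (auto simp: bij_def)
qed

end


section \<open>Transfer from functions to the Hilbert space\<close>

lemma eigenspace_eq_coord_image:
  assumes "\<And>x. coord (T x) = H (coord x)"
  shows "eigenspace H \<mu> = coord ` {x. T x = \<mu> *\<^sub>R x}"
proof
  show "eigenspace H \<mu> \<subseteq> coord ` {x. T x = \<mu> *\<^sub>R x}"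
  proof
    fix u assume u: "u \<in> eigenspace H \<mu>"
    then have "coord (Abs_ell2 u) = u"
      by (simp add: eigenspace_def Abs_ell2_inverse)
    moreover from this u have "T (Abs_ell2 u) = \<mu> *\<^sub>R Abs_ell2 u"
      by (simp add: coord_inject[symmetric] assms coord_ell2_ops eigenspace_def)
    ultimately show "u \<in> coord ` {x. T x = \<mu> *\<^sub>R x}"
      by (metis (mono_tags, lifting) image_eqI mem_Collect_eq)
  qed
  show "coord ` {x. T x = \<mu> *\<^sub>R x} \<subseteq> eigenspace H \<mu>"
    by (auto simp: eigenspace_def coord assms[symmetric] coord_ell2_ops)
qed

lemma eigenvalues_iff_ell2:
  assumes "\<And>x. coord (T x) = H (coord x)"
  shows "\<mu> \<in> eigenvalues H \<longleftrightarrow> (\<exists>x. x \<noteq> 0 \<and> T x = \<mu> *\<^sub>R x)"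
proof -
  have "coord x \<noteq> 0 \<longleftrightarrow> x \<noteq> 0" for x :: "'a ell2"
    by (metis coord_ell2_ops(1) coord_inject)
  then show ?thesis
    unfolding eigenvalues_def eigenspace_eq_coord_image[of T H, OF assms] by auto
qed

text \<open>Conjugation with \<open>coord\<close> turns a bijection of the type into one of the set
  \<open>l2\<close>.\<close>

lemma resolvent_setI_ell2:
  assumes lift: "\<And>x. coord (T x) = H (coord x)"
    and bij: "bij (\<lambda>x. T x - \<mu> *\<^sub>R x)"
    and below: "\<And>x. norm x \<le> C * norm (T x - \<mu> *\<^sub>R x)"
  shows "\<mu> \<in> resolvent_set H"
proof -
  have R: "coord (T x - \<mu> *\<^sub>R x) = H (coord x) - \<mu> *\<^sub>R coord x" for x
    by (simp add: lift coord_ell2_ops)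
  have coord_bij: "bij_betw coord UNIV l2" "bij_betw Abs_ell2 l2 UNIV"
    by (rule bij_betw_byWitness[where f' = Abs_ell2] bij_betw_byWitness[where f' = coord];
        auto simp: Abs_ell2_inverse coord_inverse coord)+
  have "bij_betw (coord \<circ> (\<lambda>x. T x - \<mu> *\<^sub>R x) \<circ> Abs_ell2) l2 l2"
    by (rule bij_betw_trans[OF coord_bij(2) bij_betw_trans[OF bij coord_bij(1)]])
  then have "bij_betw (\<lambda>u. H u - \<mu> *\<^sub>R u) l2 l2"
    by (rule iffD1[OF bij_betw_cong, rotated]) (simp add: R Abs_ell2_inverse)
  moreover have "l2_norm u \<le> C * l2_norm (H u - \<mu> *\<^sub>R u)" if "u \<in> l2" for u
    using below[of "Abs_ell2 u"] that by (simp add: norm_ell2_eq_l2_norm R Abs_ell2_inverse)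
  ultimately show ?thesis
    by (auto simp: resolvent_set_def)
qed

lemma discrete_negative_spectrum_ell2:
  fixes T :: "'a ell2 \<Rightarrow> 'a ell2"
  assumes lift: "\<And>x. coord (T x) = H (coord x)"
    and form: "\<And>c. c < 0 \<Longrightarrow> \<exists>F (\<phi> :: 'k \<Rightarrow> 'a ell2 \<Rightarrow> real) M. form_bounded_below T F \<phi> c M"
  shows "discrete_negative_spectrum H"
  unfolding discrete_negative_spectrum_def
proof (intro ballI impI)
  fix \<mu> assume spec: "\<mu> \<in> spectrum H" and "\<mu> < 0"
  \<comment> \<open>Any level strictly between \<mu> and 0 would serve.\<close>
  define c where "c = \<mu> / 2"
  have c: "c < 0" "\<mu> < c"
    using \<open>\<mu> < 0\<close> by (auto simp: c_def)
  obtain F and \<phi> :: "'k \<Rightarrow> 'a ell2 \<Rightarrow> real" and M where "form_bounded_below T F \<phi> c M"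
    using form[OF c(1)] by blast
  then interpret form_bounded_below T F \<phi> c M .
  have eig: "\<exists>x. x \<noteq> 0 \<and> T x = \<nu> *\<^sub>R x" if "\<nu> \<in> spectrum H" "\<nu> < c" for \<nu>
  proof (rule ccontr)
    assume "\<nexists>x. x \<noteq> 0 \<and> T x = \<nu> *\<^sub>R x"
    then have "\<nu> \<in> resolvent_set H"
      using bij_bounded_below_if_inj[OF that(2)] resolvent_setI_ell2[of T H, OF lift] by blast
    then show False
      using that(1) by (simp add: spectrum_def)
  qed
  \<comment> \<open>The isolating neighbourhood: below \<open>c\<close> the spectrum consists of
    finitely many eigenvalues, and all except \<mu> are removed.\<close>
  let ?U = "{..<c} - ({\<nu>. \<nu> < c \<and> (\<exists>x. x \<noteq> 0 \<and> T x = \<nu> *\<^sub>R x)} - {\<mu>})"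
  have "\<mu> isolated_in spectrum H"
    unfolding isolated_in_def
  proof (intro conjI exI)
    show "open ?U"
      by (intro open_Diff open_lessThan finite_imp_closed finite_Diff finite_eigenvalues)
    show "?U \<inter> spectrum H = {\<mu>}"
      using eig c spec by auto
  qed (rule spec)
  moreover have "\<mu> \<in> eigenvalues H"
    using eig[OF spec c(2)] eigenvalues_iff_ell2[of T H, OF lift] by blast
  moreover obtain B where "finite B" and B: "{x. T x = \<mu> *\<^sub>R x} = span B"
    using eigenvectors_finite_span[OF c(2)] by metis
  moreover have "eigenspace H \<mu> \<subseteq> span (coord ` B)"
    by (simp add: eigenspace_eq_coord_image[of T H, OF lift] B linear_span_image[OF linear_coord])
  ultimately show "\<mu> isolated_in spectrum H \<and> \<mu> \<in> eigenvalues H \<and>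
      (\<exists>B. finite B \<and> eigenspace H \<mu> \<subseteq> span B)"
    by blast
qed

section \<open>Orthonormal eigenvectors and the eigenvalue sum\<close>

lemma orthonormal_basis_exists:
  fixes B :: "'a::real_inner set"
  assumes "finite B"
  obtains C where "finite C" "pairwise orthogonal C" "\<And>x. x \<in> C \<Longrightarrow> norm x = 1" "span C = span B"
proof -
  obtain D where D: "finite D" "span D = span B" "pairwise orthogonal D"
    using basis_orthogonal[OF assms] by blast
  \<comment> \<open>The orthogonal spanning set may contain 0, which cannot be normalised.\<close>
  define C where "C = (\<lambda>x. x /\<^sub>R norm x) ` (D - {0})"
  show thesis
  proof (rule that)
    show "finite C"
      using D(1) by (simp add: C_def)
    have "orthogonal x y" if "x \<in> D" "y \<in> D" "x /\<^sub>R norm x \<noteq> y /\<^sub>R norm y" for x y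
      using D(3) that by (metis pairwise_def)
    then show "pairwise orthogonal C"
      by (auto simp: C_def pairwise_def orthogonal_def)
    show "norm x = 1" if x: "x \<in> C" for x
    proof -
      from x obtain y where "y \<noteq> 0" "x = y /\<^sub>R norm y"
        unfolding C_def by blast
      then show ?thesis
        by simp
    qed
    have "C \<subseteq> span D"
      by (auto simp: C_def intro: span_scale span_base)
    moreover have "D \<subseteq> span C"
    proof
      fix x assume "x \<in> D"
      show "x \<in> span C"
      proof (cases "x = 0")
        case False
        then have "x /\<^sub>R norm x \<in> span C"
          using \<open>x \<in> D\<close> by (auto simp: C_def intro: span_base)
        then have "norm x *\<^sub>R (x /\<^sub>R norm x) \<in> span C"
          by (rule span_scale)
        with False show ?thesis
          by simp
      qed (simp add: span_zero)
    qed
    ultimately show "span C = span B"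
      using D(2) by (metis span_eq)
  qed
qed

text \<open>It suffices to bound finite partial sums. Orthonormal bases of finitely many eigenspaces
  unite to one orthonormal system, in which each vector for \<mu> contributes its absolute
  value.\<close>

lemma negative_eigenvalue_sum_le_ell2:
  fixes T :: "'a ell2 \<Rightarrow> 'a ell2"
  assumes lift: "\<And>x. coord (T x) = H (coord x)"
    and form: "\<And>c. c < 0 \<Longrightarrow> \<exists>F (\<phi> :: 'k \<Rightarrow> 'a ell2 \<Rightarrow> real) M. form_bounded_below T F \<phi> c M"
    and bound: "\<And>E. finite E \<Longrightarrow> pairwise orthogonal E \<Longrightarrow> (\<And>x. x \<in> E \<Longrightarrow> norm x = 1) \<Longrightarrow>
      ennreal (\<Sum>x\<in>E. - inner (T x) x) \<le> S"
  shows "negative_eigenvalue_sum H \<le> S"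
  unfolding negative_eigenvalue_sum_def
proof (rule infsum_le_finite_sums)
  fix \<Lambda> assume \<Lambda>: "finite \<Lambda>" "\<Lambda> \<subseteq> {\<mu> \<in> eigenvalues H. \<mu> < 0}"
  have "\<exists>C. finite C \<and> pairwise orthogonal C \<and> (\<forall>x\<in>C. norm x = 1) \<and> (\<forall>x\<in>C. T x = \<mu> *\<^sub>R x)
      \<and> dim (eigenspace H \<mu>) \<le> card C" if "\<mu> < 0" for \<mu>
  proof -
    have "\<mu> / 2 < 0" "\<mu> < \<mu> / 2"
      using \<open>\<mu> < 0\<close> by auto
    obtain F and \<phi> :: "'k \<Rightarrow> 'a ell2 \<Rightarrow> real" and M where "form_bounded_below T F \<phi> (\<mu> / 2) M"
      using form[OF \<open>\<mu> / 2 < 0\<close>] by blast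
    then interpret form_bounded_below T F \<phi> "\<mu> / 2" M .
    obtain B where B: "finite B" "{x. T x = \<mu> *\<^sub>R x} = span B"
      using eigenvectors_finite_span[OF \<open>\<mu> < \<mu> / 2\<close>] by metis
    obtain C where C: "finite C" "pairwise orthogonal C" "\<And>x. x \<in> C \<Longrightarrow> norm x = 1" "span C = span B"
      using orthonormal_basis_exists[OF B(1)] by blast
    have "eigenspace H \<mu> \<subseteq> span (coord ` C)"
      by (simp add: eigenspace_eq_coord_image[of T H, OF lift] B(2) C(4) linear_span_image[OF linear_coord])
    then have "dim (eigenspace H \<mu>) \<le> card (coord ` C)"
      using C(1) by (intro dim_le_card) auto
    also have "\<dots> \<le> card C"
      using C(1) by (rule card_image_le)
    finally have "dim (eigenspace H \<mu>) \<le> card C" .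
    moreover have "\<forall>x\<in>C. T x = \<mu> *\<^sub>R x"
    proof
      fix x assume "x \<in> C"
      then have "x \<in> {x. T x = \<mu> *\<^sub>R x}"
        unfolding B(2) C(4)[symmetric] by (rule span_base)
      then show "T x = \<mu> *\<^sub>R x"
        by simp
    qed
    ultimately show ?thesis
      using C(1-3) by (intro exI[of _ C] conjI ballI) auto
  qed
  then have "\<forall>\<mu>. \<exists>C. \<mu> < 0 \<longrightarrow> finite C \<and> pairwise orthogonal C \<and> (\<forall>x\<in>C. norm x = 1) \<and>
      (\<forall>x\<in>C. T x = \<mu> *\<^sub>R x) \<and> dim (eigenspace H \<mu>) \<le> card C"
    by auto
  from choice[OF this] obtain C0 where C0: "\<forall>\<mu><0. finite (C0 \<mu>) \<and> pairwise orthogonal (C0 \<mu>) \<and>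
      (\<forall>x\<in>C0 \<mu>. norm x = 1) \<and> (\<forall>x\<in>C0 \<mu>. T x = \<mu> *\<^sub>R x) \<and> dim (eigenspace H \<mu>) \<le> card (C0 \<mu>)"
    by blast
  have neg: "\<mu> < 0" if "\<mu> \<in> \<Lambda>" for \<mu>
    using \<Lambda>(2) that by blast
  obtain C where fin: "\<And>\<mu>. \<mu> \<in> \<Lambda> \<Longrightarrow> finite (C \<mu>)"
    and C_orth: "\<And>\<mu>. \<mu> \<in> \<Lambda> \<Longrightarrow> pairwise orthogonal (C \<mu>)"
    and unit: "\<And>\<mu> x. \<mu> \<in> \<Lambda> \<Longrightarrow> x \<in> C \<mu> \<Longrightarrow> norm x = 1"
    and eig: "\<And>\<mu> x. \<mu> \<in> \<Lambda> \<Longrightarrow> x \<in> C \<mu> \<Longrightarrow> T x = \<mu> *\<^sub>R x"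
    and card: "\<And>\<mu>. \<mu> \<in> \<Lambda> \<Longrightarrow> dim (eigenspace H \<mu>) \<le> card (C \<mu>)"
    by (rule that[of C0]) (use C0 neg in auto)
  \<comment> \<open>The level -1 is arbitrary: the instance only provides symmetry, hence
    orthogonality of eigenvectors for different eigenvalues.\<close>
  have "(- 1 :: real) < 0"
    by simp
  then obtain F and \<phi> :: "'k \<Rightarrow> 'a ell2 \<Rightarrow> real" and M where "form_bounded_below T F \<phi> (- 1) M"
    using form by blast
  then interpret form_bounded_below T F \<phi> "- 1" M .
  have orth: "orthogonal x y" if "\<mu> \<in> \<Lambda>" "\<nu> \<in> \<Lambda>" "x \<in> C \<mu>" "y \<in> C \<nu>" "\<mu> \<noteq> \<nu>" for \<mu> \<nu> x y
    by (rule eigenvectors_orthogonal[OF eig eig]) (use that in auto)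
  have disj: "C \<mu> \<inter> C \<nu> = {}" if "\<mu> \<in> \<Lambda>" "\<nu> \<in> \<Lambda>" "\<mu> \<noteq> \<nu>" for \<mu> \<nu>
  proof (rule ccontr)
    assume "C \<mu> \<inter> C \<nu> \<noteq> {}"
    then obtain x where "x \<in> C \<mu>" "x \<in> C \<nu>"
      by blast
    then have "x = 0" "norm x = 1"
      using orth[of \<mu> \<nu> x x] that unit[of \<mu> x] by (auto simp: orthogonal_def)
    then show False
      by simp
  qed
  let ?E = "\<Union>\<mu>\<in>\<Lambda>. C \<mu>"
  have "(\<Sum>\<mu>\<in>\<Lambda>. of_nat (dim (eigenspace H \<mu>)) * ennreal \<bar>\<mu>\<bar>)
      \<le> (\<Sum>\<mu>\<in>\<Lambda>. ennreal (real (card (C \<mu>)) * \<bar>\<mu>\<bar>))"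
  proof (rule sum_mono)
    fix \<mu> assume "\<mu> \<in> \<Lambda>"
    then have "dim (eigenspace H \<mu>) \<le> card (C \<mu>)"
      by (rule card)
    then show "of_nat (dim (eigenspace H \<mu>)) * ennreal \<bar>\<mu>\<bar> \<le> ennreal (real (card (C \<mu>)) * \<bar>\<mu>\<bar>)"
      by (simp add: ennreal_mult ennreal_of_nat_eq_real_of_nat mult_right_mono ennreal_leI)
  qed
  also have "\<dots> = ennreal (\<Sum>\<mu>\<in>\<Lambda>. real (card (C \<mu>)) * \<bar>\<mu>\<bar>)"
    by (rule sum_ennreal) simp
  also have "(\<Sum>\<mu>\<in>\<Lambda>. real (card (C \<mu>)) * \<bar>\<mu>\<bar>) = (\<Sum>\<mu>\<in>\<Lambda>. \<Sum>x\<in>C \<mu>. - inner (T x) x)"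
  proof (rule sum.cong)
    fix \<mu> assume mu: "\<mu> \<in> \<Lambda>"
    have "- inner (T x) x = \<bar>\<mu>\<bar>" if "x \<in> C \<mu>" for x
      using eig[OF mu that] unit[OF mu that] neg[OF mu] by (simp add: norm_eq_1)
    then show "real (card (C \<mu>)) * \<bar>\<mu>\<bar> = (\<Sum>x\<in>C \<mu>. - inner (T x) x)"
      by simp
  qed simp
  also have "\<dots> = (\<Sum>x\<in>?E. - inner (T x) x)"
    using \<Lambda>(1) fin disj by (intro sum.UNION_disjoint[symmetric]) auto
  also have "ennreal \<dots> \<le> S"
  proof (rule bound)
    show "finite ?E"
      using \<Lambda>(1) fin by blast
    show "pairwise orthogonal ?E"
    proof (rule pairwiseI)
      fix x y assume "x \<in> ?E" "y \<in> ?E" "x \<noteq> y"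
      then obtain \<mu> \<nu> where *: "\<mu> \<in> \<Lambda>" "\<nu> \<in> \<Lambda>" "x \<in> C \<mu>" "y \<in> C \<nu>"
        by blast
      show "orthogonal x y"
      proof (cases "\<mu> = \<nu>")
        case True
        then show ?thesis
          using C_orth[OF *(1)] * \<open>x \<noteq> y\<close> by (auto simp: pairwise_def)
      qed (use orth * in blast)
    qed
    show "norm x = 1" if "x \<in> ?E" for x
      using that unit by blast
  qed
  finally show "(\<Sum>\<mu>\<in>\<Lambda>. of_nat (dim (eigenspace H \<mu>)) * ennreal \<bar>\<mu>\<bar>) \<le> S" .
qed (rule nonneg_summable_on_complete, simp)


section \<open>Difference operators and multiplication operators on the Hilbert space\<close>

definition shift :: "int ^ 'd \<Rightarrow> (int ^ 'd::finite) ell2 \<Rightarrow> (int ^ 'd) ell2" where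
  "shift a x = Abs_ell2 (\<lambda>k. coord x (k + a))"

lemma coord_shift [simp]: "coord (shift a x) = (\<lambda>k. coord x (k + a))"
  by (simp add: shift_def Abs_ell2_inverse l2_shift coord)

lemma inner_shift: "inner (shift a x) y = inner x (shift (- a) y)"
proof -
  have "((\<lambda>k. coord x (k + a) * coord (shift (- a) y) (k + a)) has_sum inner x (shift (- a) y)) UNIV"
    using has_sum_reindex_bij_betw[OF bij_plus_right,
        of "\<lambda>k. coord x k * coord (shift (- a) y) k" a "inner x (shift (- a) y)"]
      has_sum_inner_ell2[of x "shift (- a) y"] by simp
  then show ?thesis
    using has_sum_inner_ell2[of "shift a x" y] by (simp add: has_sum_unique)
qed

text \<open>The adjoint \<open>shift (- a)\<close> is also a left inverse, so norms are
  preserved.\<close>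

lemma bounded_linear_shift: "bounded_linear (shift a)"
proof (rule bounded_linear_intro[where K = 1])
  show "shift a (x + y) = shift a x + shift a y" "shift a (r *\<^sub>R x) = r *\<^sub>R shift a x" for x y r
    by (simp_all add: coord_inject[symmetric] fun_eq_iff)
  have "shift (- a) (shift a x) = x" for x
    by (simp add: coord_inject[symmetric])
  then show "norm (shift a x) \<le> norm x * 1" for x
    by (simp add: norm_eq_sqrt_inner inner_shift)
qed

definition diff_ell2 :: "'d \<Rightarrow> (int ^ 'd::finite) ell2 \<Rightarrow> (int ^ 'd) ell2" where
  "diff_ell2 i x = shift (axis i 1) x - x"

definition diff_adj_ell2 :: "'d \<Rightarrow> (int ^ 'd::finite) ell2 \<Rightarrow> (int ^ 'd) ell2" where
  "diff_adj_ell2 i x = shift (- axis i 1) x - x"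

definition laplacian_ell2 :: "(int ^ 'd::finite) ell2 \<Rightarrow> (int ^ 'd) ell2" where
  "laplacian_ell2 x = - (\<Sum>i\<in>UNIV. diff_adj_ell2 i (diff_ell2 i x))"

lemma coord_diff_ell2: "coord (diff_ell2 i x) = diff_op i (coord x)"
  by (simp add: diff_ell2_def diff_op_def fun_eq_iff)

lemma coord_diff_adj_ell2: "coord (diff_adj_ell2 i x) = diff_adj i (coord x)"
  by (simp add: diff_adj_ell2_def diff_adj_def fun_eq_iff)

lemma coord_laplacian_ell2: "coord (laplacian_ell2 x) = laplacian (coord x)"
  by (simp add: laplacian_ell2_def laplacian_def fun_eq_iff fun_sum_apply coord_diff_adj_ell2
      coord_diff_ell2)

lemma coord_laplacian_ell2_power: "coord ((laplacian_ell2 ^^ m) x) = (laplacian ^^ m) (coord x)"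
  by (induction m) (simp_all add: coord_laplacian_ell2)

lemma inner_diff_ell2: "inner (diff_ell2 i x) y = inner x (diff_adj_ell2 i y)"
  by (simp add: diff_ell2_def diff_adj_ell2_def inner_diff_left inner_diff_right inner_shift)

lemma bounded_linear_laplacian_ell2: "bounded_linear laplacian_ell2"
proof -
  have "bounded_linear (diff_ell2 i)" "bounded_linear (diff_adj_ell2 i)" for i :: "'d::finite"
    unfolding diff_ell2_def[abs_def] diff_adj_ell2_def[abs_def]
    by (rule bounded_linear_sub[OF bounded_linear_shift bounded_linear_ident])+
  then have "bounded_linear (\<lambda>x. diff_adj_ell2 i (diff_ell2 i x))" for i :: "'d::finite"
    by (rule bounded_linear_compose[rotated])
  then show ?thesis
    unfolding laplacian_ell2_def[abs_def] by (intro bounded_linear_minus bounded_linear_sum)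
qed

lemma inner_laplacian_ell2:
  "inner (laplacian_ell2 x) y = - (\<Sum>i\<in>UNIV. inner (diff_ell2 i x) (diff_ell2 i y))"
proof -
  have "inner (diff_adj_ell2 i (diff_ell2 i x)) y = inner (diff_ell2 i x) (diff_ell2 i y)" for i
    using inner_diff_ell2[of i y "diff_ell2 i x"] by (metis inner_commute)
  then show ?thesis
    by (simp add: laplacian_ell2_def inner_sum_left)
qed

lemma laplacian_ell2_sym: "inner (laplacian_ell2 x) y = inner x (laplacian_ell2 y)"
proof -
  have "inner (laplacian_ell2 x) y = inner (laplacian_ell2 y) x"
    unfolding inner_laplacian_ell2 by (simp only: inner_commute)
  then show ?thesis
    by (simp only: inner_commute)
qed

lemma bounded_linear_laplacian_ell2_power: "bounded_linear (laplacian_ell2 ^^ m)"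
proof (induction m)
  case (Suc m)
  then show ?case
    using bounded_linear_compose[OF bounded_linear_laplacian_ell2 Suc] by (simp add: o_def)
qed (simp add: id_def)

lemma laplacian_ell2_power_sym:
  "inner ((laplacian_ell2 ^^ m) x) y = inner x ((laplacian_ell2 ^^ m) y)"
proof (induction m arbitrary: y)
  case (Suc m)
  have "inner ((laplacian_ell2 ^^ Suc m) x) y = inner x ((laplacian_ell2 ^^ m) (laplacian_ell2 y))"
    by (simp add: laplacian_ell2_sym Suc)
  then show ?case
    by (simp add: funpow_swap1)
qed simp

section \<open>The kinetic energy\<close>

definition kinetic :: "nat \<Rightarrow> (int ^ 'd::finite) ell2 \<Rightarrow> (int ^ 'd) ell2" where
  "kinetic n x = (-1) ^ n *\<^sub>R (laplacian_ell2 ^^ n) x"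

lemma bounded_linear_kinetic: "bounded_linear (kinetic n)"
  unfolding kinetic_def[abs_def]
  by (rule bounded_linear_const_scaleR[OF bounded_linear_laplacian_ell2_power])

lemma kinetic_sym: "inner (kinetic n x) y = inner x (kinetic n y)"
  by (simp add: kinetic_def laplacian_ell2_power_sym)

text \<open>Half of the Laplacians move to the other argument. For odd n one remains, and summation
  by parts turns it into the gradient; its minus sign cancels against
  \<open>(-1) ^ n\<close>.\<close>

lemma inner_kinetic: "inner (kinetic n x) x = (Dn_norm n (coord x))\<^sup>2"
proof (cases "even n")
  case True
  define m where "m = n div 2"
  define z where "z = (laplacian_ell2 ^^ m) x"
  have n: "n = m + m"
    using True unfolding m_def by presburger
  have "(laplacian_ell2 ^^ n) x = (laplacian_ell2 ^^ m) z"
    unfolding n z_def funpow_add by simp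
  then have "inner (kinetic n x) x = inner z z"
    using True by (simp add: kinetic_def z_def laplacian_ell2_power_sym)
  then show ?thesis
    using True by (simp add: Dn_norm_def z_def m_def coord_laplacian_ell2_power[symmetric]
        norm_ell2_eq_l2_norm[symmetric] power2_norm_eq_inner)
next
  case False
  define m where "m = (n - 1) div 2"
  define z where "z = (laplacian_ell2 ^^ m) x"
  have n: "n = m + Suc m"
    using False unfolding m_def by presburger
  have "(laplacian_ell2 ^^ n) x = (laplacian_ell2 ^^ m) (laplacian_ell2 z)"
    unfolding n z_def funpow_add by simp
  then have "inner (kinetic n x) x = - inner (laplacian_ell2 z) z"
    using False by (simp add: kinetic_def z_def laplacian_ell2_power_sym)
  also have "\<dots> = (\<Sum>i\<in>UNIV. (norm (diff_ell2 i z))\<^sup>2)"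
    by (simp add: inner_laplacian_ell2 power2_norm_eq_inner)
  finally show ?thesis
    using False by (simp add: Dn_norm_def grad_norm_def z_def m_def sum_nonneg
        coord_laplacian_ell2_power[symmetric] norm_ell2_eq_l2_norm coord_diff_ell2)
qed

section \<open>Bounded potentials as multiplication operators\<close>

definition mult_ell2 :: "('a \<Rightarrow> real) \<Rightarrow> 'a ell2 \<Rightarrow> 'a ell2" where
  "mult_ell2 V x = Abs_ell2 (\<lambda>k. V k * coord x k)"

context
  fixes V :: "'a \<Rightarrow> real" and B :: real
  assumes V_bound: "\<And>k. \<bar>V k\<bar> \<le> B"
begin

lemma mult_ell2_partial_sums:
  assumes "finite S"
  shows "(\<Sum>k\<in>S. (V k * coord x k)\<^sup>2) \<le> B\<^sup>2 * (norm x)\<^sup>2"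
proof -
  have "(V k * coord x k)\<^sup>2 \<le> B\<^sup>2 * (coord x k)\<^sup>2" for k
  proof -
    have "\<bar>V k\<bar>\<^sup>2 \<le> B\<^sup>2"
      by (rule power_mono) (use V_bound in auto)
    then show ?thesis
      by (simp add: power_mult_distrib mult_right_mono)
  qed
  then have "(\<Sum>k\<in>S. (V k * coord x k)\<^sup>2) \<le> B\<^sup>2 * (\<Sum>k\<in>S. (coord x k)\<^sup>2)"
    by (simp add: sum_distrib_left sum_mono)
  also have "\<dots> \<le> B\<^sup>2 * (norm x)\<^sup>2"
    using sum_coord_le_norm[OF assms] by (simp add: mult_left_mono)
  finally show ?thesis .
qed

text \<open>Boundedness of \<open>V\<close> keeps the product in \<open>l2\<close>, where
  \<open>Abs_ell2\<close> is inverted by \<open>coord\<close>.\<close>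

lemma coord_mult_ell2: "coord (mult_ell2 V x) k = V k * coord x k"
  using ell2_bounded_partial_sums(1)[OF mult_ell2_partial_sums]
  by (simp add: mult_ell2_def Abs_ell2_inverse)

lemma bounded_linear_mult_ell2: "bounded_linear (mult_ell2 V)"
proof (rule bounded_linear_intro[where K = B])
  show "mult_ell2 V (x + y) = mult_ell2 V x + mult_ell2 V y"
    "mult_ell2 V (r *\<^sub>R x) = r *\<^sub>R mult_ell2 V x" for x y r
    by (simp_all add: coord_inject[symmetric] fun_eq_iff coord_mult_ell2 algebra_simps)
  have "B \<ge> 0"
    using V_bound[of undefined] by linarith
  then show "norm (mult_ell2 V x) \<le> norm x * B" for x
    using ell2_bounded_partial_sums(2)[OF mult_ell2_partial_sums, of x]
    by (simp add: mult_ell2_def real_sqrt_mult mult.commute)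
qed

lemma has_sum_mult_ell2: "((\<lambda>k. V k * (coord x k * coord y k)) has_sum inner (mult_ell2 V x) y) UNIV"
  using has_sum_inner_ell2[of "mult_ell2 V x" y] by (simp add: coord_mult_ell2 mult.assoc)

lemma mult_ell2_sym: "inner (mult_ell2 V x) y = inner x (mult_ell2 V y)"
  using has_sum_mult_ell2[of x y] has_sum_mult_ell2[of y x]
  by (simp add: mult.commute[of "coord y _"] has_sum_unique inner_commute[of x])

lemma schroedinger_form_bounded_below:
  fixes A :: "'a ell2 \<Rightarrow> 'a ell2"
  assumes A: "bounded_linear A" "\<And>x y. inner (A x) y = inner x (A y)" "\<And>x. inner (A x) x \<ge> 0"
    and "finite {k. V k \<ge> \<epsilon>}" and "\<epsilon> > 0"
  shows "form_bounded_below (\<lambda>x. A x - mult_ell2 V x) {k. V k \<ge> \<epsilon>} (\<lambda>k x. coord x k) (- \<epsilon>) B"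
proof (rule form_bounded_below.intro)
  let ?F = "{k. V k \<ge> \<epsilon>}"
  show "finite ?F"
    by fact
  show "bounded_linear (\<lambda>x. coord x k)" for k :: 'a
    by (rule bounded_linear_coord)
  show "bounded_linear (\<lambda>x. A x - mult_ell2 V x)"
    by (intro bounded_linear_sub A bounded_linear_mult_ell2)
  show "inner (A x - mult_ell2 V x) y = inner x (A y - mult_ell2 V y)" for x y
    by (simp add: inner_diff_left inner_diff_right A mult_ell2_sym)
  fix x
  \<comment> \<open>A majorant of the potential energy density: \<open>V\<close> is below \<epsilon>
    off \<open>?F\<close> and at most \<open>B\<close> on it. Keeping the \<epsilon> term on
    \<open>?F\<close> too makes it sum to a multiple of the squared norm.\<close>
  have "((\<lambda>k. \<epsilon> * (coord x k)\<^sup>2 + (if k \<in> ?F then B * (coord x k)\<^sup>2 else 0))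
      has_sum (\<epsilon> * (norm x)\<^sup>2 + (\<Sum>k\<in>?F. B * (coord x k)\<^sup>2))) UNIV"
    by (intro has_sum_add has_sum_cmult_right has_sum_norm_ell2
        has_sum_finite_neutralI[OF \<open>finite ?F\<close>]) auto
  moreover have "V k * (coord x k * coord x k)
      \<le> \<epsilon> * (coord x k)\<^sup>2 + (if k \<in> ?F then B * (coord x k)\<^sup>2 else 0)" for k
  proof (cases "k \<in> ?F")
    case True
    have "V k * (coord x k)\<^sup>2 \<le> B * (coord x k)\<^sup>2"
      using V_bound[of k] by (intro mult_right_mono) auto
    moreover have "0 \<le> \<epsilon> * (coord x k)\<^sup>2"
      using \<open>\<epsilon> > 0\<close> by simp
    ultimately show ?thesis
      using True by (simp add: power2_eq_square)
  next
    case False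
    then have "V k * (coord x k)\<^sup>2 \<le> \<epsilon> * (coord x k)\<^sup>2"
      by (intro mult_right_mono) auto
    with False show ?thesis
      by (simp add: power2_eq_square)
  qed
  ultimately have "inner (mult_ell2 V x) x \<le> \<epsilon> * (norm x)\<^sup>2 + (\<Sum>k\<in>?F. B * (coord x k)\<^sup>2)"
    by (intro has_sum_mono[OF has_sum_mult_ell2])
  then show "- \<epsilon> * (norm x)\<^sup>2 - B * (\<Sum>k\<in>?F. (coord x k)\<^sup>2) \<le> inner (A x - mult_ell2 V x) x"
    using A(3)[of x] by (simp add: inner_diff_left sum_distrib_left)
qed

end


section \<open>The Lieb--Thirring inequality for orthonormal systems\<close>

lemma has_sum_finite_sum:
  fixes f :: "'i \<Rightarrow> 'a \<Rightarrow> real"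
  assumes "\<And>i. i \<in> I \<Longrightarrow> (f i has_sum s i) A"
  shows "((\<lambda>k. \<Sum>i\<in>I. f i k) has_sum (\<Sum>i\<in>I. s i)) A"
  using assms
proof (induction I rule: infinite_finite_induct)
  case (insert i I)
  have "((\<lambda>k. f i k + (\<Sum>i\<in>I. f i k)) has_sum (s i + (\<Sum>i\<in>I. s i))) A"
    by (intro has_sum_add insert) auto
  with insert show ?case
    by simp
qed simp_all

text \<open>
  The bound is Young's inequality for the exponents \<open>\<alpha> = (1 - \<theta>) / (2 - \<theta>)\<close> and
  \<open>1 - \<alpha> = 1 / (2 - \<theta>)\<close>: the second factor is chosen such that the first one
  contributes exactly \<open>q\<close>.
\<close>

lemma lieb_thirring_pointwise:
  fixes \<theta> C \<rho> q v :: real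
  assumes \<theta>: "0 \<le> \<theta>" "\<theta> < 1" and nn: "0 \<le> C" "0 \<le> \<rho>" "0 \<le> q" "0 \<le> v"
    and interp: "\<rho>\<^sup>2 \<le> C * \<rho> powr \<theta> * q powr (1 - \<theta>)"
  shows "v * \<rho> - q \<le> C * ((1 - \<theta>) powr (1 - \<theta>) / (2 - \<theta>) powr (2 - \<theta>)) * v powr (2 - \<theta>)"
\<comment> \<open>If either vanishes, the left side is at most 0. Otherwise \<open>interp\<close>
  forces \<open>C\<close> and \<open>q\<close> to be positive, so that \<open>0 powr\<close> does
  not occur below.\<close>
proof (cases "\<rho> = 0 \<or> v = 0")
  case True
  moreover have "0 \<le> C * ((1 - \<theta>) powr (1 - \<theta>) / (2 - \<theta>) powr (2 - \<theta>)) * v powr (2 - \<theta>)"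
    using nn(1) by simp
  ultimately show ?thesis
    using nn(3) by auto
next
  case False
  then have pos: "\<rho> > 0" "v > 0"
    using nn by auto
  have "0 < C * \<rho> powr \<theta> * q powr (1 - \<theta>)"
    using interp pos(1) by (meson less_le_trans zero_less_power)
  then have pos': "C > 0" "q > 0"
    using nn by (auto simp: zero_less_mult_iff less_le)
  define \<alpha> where "\<alpha> = (1 - \<theta>) / (2 - \<theta>)"
  define \<beta> where "\<beta> = 1 / (2 - \<theta>)"
  \<comment> \<open>Solves \<open>(q / \<alpha>) powr \<alpha> * b powr \<beta> = v * (C powr
    \<beta> * q powr \<alpha>)\<close>, using
    \<open>1 - \<theta> = \<alpha> * (2 - \<theta>)\<close>.\<close>
  define b where "b = v powr (2 - \<theta>) * C * \<alpha> powr (1 - \<theta>)"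
  have \<alpha>: "\<alpha> > 0" "\<alpha> + \<beta> = 1" "(2 - \<theta>) * \<beta> = 1" "(1 - \<theta>) * \<beta> = \<alpha>" and \<beta>: "\<beta> > 0"
    using \<theta> by (auto simp: \<alpha>_def \<beta>_def field_simps)
  have "\<rho> powr (2 - \<theta>) * \<rho> powr \<theta> \<le> (C * q powr (1 - \<theta>)) * \<rho> powr \<theta>"
    using interp pos(1) by (simp add: powr_add[symmetric] mult_ac)
  then have "\<rho> powr (2 - \<theta>) \<le> C * q powr (1 - \<theta>)"
    using pos(1) by simp
  then have "(\<rho> powr (2 - \<theta>)) powr \<beta> \<le> (C * q powr (1 - \<theta>)) powr \<beta>"
    using \<beta> by (intro powr_mono2) auto
  then have "\<rho> \<le> C powr \<beta> * q powr \<alpha>"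
    using pos pos' by (simp add: powr_powr powr_mult \<alpha>(3,4))
  then have "v * \<rho> \<le> v * (C powr \<beta> * q powr \<alpha>)"
    using pos by simp
  also have "\<dots> = (q / \<alpha>) powr \<alpha> * b powr \<beta>"
    using pos pos' \<alpha>(1) by (simp add: b_def powr_mult powr_divide powr_powr \<alpha>(3,4))
  also have "\<dots> \<le> \<alpha> * (q / \<alpha>) + \<beta> * b"
    using pos pos' \<alpha> \<beta> by (intro Youngs_inequality_0) (auto simp: b_def)
  \<comment> \<open>The constant of the theorem is
    \<open>\<beta> * \<alpha> powr (1 - \<theta>)\<close>.\<close>
  also have "\<beta> * b = C * ((1 - \<theta>) powr (1 - \<theta>) / (2 - \<theta>) powr (2 - \<theta>)) * v powr (2 - \<theta>)"
  proof -
    have "\<beta> * \<alpha> powr (1 - \<theta>) = (1 - \<theta>) powr (1 - \<theta>) / ((2 - \<theta>) powr (1 - \<theta>) * (2 - \<theta>) powr 1)"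
      using \<theta> by (simp add: \<alpha>_def \<beta>_def powr_divide)
    also have "\<dots> = (1 - \<theta>) powr (1 - \<theta>) / (2 - \<theta>) powr (2 - \<theta>)"
      unfolding powr_add[symmetric] by simp
    finally have *: "\<beta> * \<alpha> powr (1 - \<theta>) = (1 - \<theta>) powr (1 - \<theta>) / (2 - \<theta>) powr (2 - \<theta>)" .
    show ?thesis
      unfolding *[symmetric] by (simp add: b_def)
  qed
  finally show ?thesis
    using \<alpha>(1) by simp
qed

text \<open>A real \<open>SUP\<close> dominates its members only if they are bounded above; here the
  squared norm is a bound.\<close>

lemma interp_admissible_bound:
  fixes x :: "(int ^ 'd::finite) ell2"
  assumes C: "interp_admissible TYPE('d) n \<theta> C"
  shows "(coord x k)\<^sup>2 \<le> C * norm x powr (2 * \<theta>) * Dn_norm n (coord x) powr (2 * (1 - \<theta>))"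
proof -
  have "(coord x k)\<^sup>2 \<le> (SUP k. (coord x k)\<^sup>2)"
    by (rule cSUP_upper2[OF _ UNIV_I order_refl])
      (auto intro: bdd_aboveI2[where M = "(norm x)\<^sup>2"] coord_square_le_norm)
  also have "\<dots> \<le> C * norm x powr (2 * \<theta>) * Dn_norm n (coord x) powr (2 * (1 - \<theta>))"
    using C coord[of x] by (simp add: interp_admissible_def norm_ell2_eq_l2_norm)
  finally show ?thesis .
qed

lemma Dn_norm_nonneg: "0 \<le> Dn_norm n u"
  by (auto simp: Dn_norm_def grad_norm_def l2_norm_def intro!: infsum_nonneg sum_nonneg)

lemma powr_double: "0 \<le> a \<Longrightarrow> a powr (2 * s) = (a\<^sup>2) powr s" for a s :: real
  by (metis powr_numeral powr_powr zero_le_power2 order_le_less powr_0 power_zero_numeral)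

lemma lieb_thirring_orthonormal:
  fixes E :: "(int ^ 'd::finite) ell2 set" and V :: "int ^ 'd \<Rightarrow> real"
  assumes \<theta>: "0 \<le> \<theta>" "\<theta> < 1"
    and C: "interp_admissible TYPE('d) n \<theta> C"
    and V: "\<And>k. 0 \<le> V k" "\<And>k. V k \<le> B"
    and summable: "(\<lambda>k. V k powr (2 - \<theta>)) summable_on UNIV"
    and E: "finite E" "pairwise orthogonal E" "\<And>x. x \<in> E \<Longrightarrow> norm x = 1"
  shows "(\<Sum>x\<in>E. - inner (kinetic n x - mult_ell2 V x) x)
    \<le> C * ((1 - \<theta>) powr (1 - \<theta>) / (2 - \<theta>) powr (2 - \<theta>)) * (\<Sum>\<^sub>\<infinity>k. V k powr (2 - \<theta>))"
proof -
  define \<rho> where "\<rho> k = (\<Sum>x\<in>E. (coord x k)\<^sup>2)" for k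
  \<comment> \<open>The projection of the unit vector at k onto \<open>span E\<close>: pairing it
    with \<open>x\<close> in \<open>E\<close> returns \<open>coord x k\<close>.\<close>
  define y where "y k = (\<Sum>x\<in>E. coord x k *\<^sub>R x)" for k
  define q where "q k = inner (kinetic n (y k)) (y k)" for k
  have VB: "\<bar>V k\<bar> \<le> B" for k
    using V[of k] by simp
  interpret A: bounded_linear "kinetic n :: (int ^ 'd) ell2 \<Rightarrow> _"
    by (rule bounded_linear_kinetic)
  have delta: "inner x z = (if x = z then 1 else 0)" if "x \<in> E" "z \<in> E" for x z
    using that E(2,3) by (auto simp: pairwise_def orthogonal_def norm_eq_1)
  have q: "q k = (\<Sum>x\<in>E. \<Sum>z\<in>E. inner (kinetic n x) z * (coord x k * coord z k))" for k
    unfolding q_def y_def A.sum A.scale inner_sum_left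
    by (simp add: inner_sum_right sum_distrib_left mult_ac)
  \<comment> \<open>Summing over k turns the products of coordinates into inner products, and
    orthonormality leaves only the diagonal, the trace of the kinetic operator on
    \<open>E\<close>.\<close>
  have "(q has_sum (\<Sum>x\<in>E. \<Sum>z\<in>E. inner (kinetic n x) z * inner x z)) UNIV"
    unfolding q by (intro has_sum_finite_sum has_sum_cmult_right has_sum_inner_ell2)
  also have "(\<Sum>x\<in>E. \<Sum>z\<in>E. inner (kinetic n x) z * inner x z) = (\<Sum>x\<in>E. inner (kinetic n x) x)"
    using E(1) by (intro sum.cong refl) (simp add: delta if_distrib cong: if_cong)
  finally have q_sum: "(q has_sum (\<Sum>x\<in>E. inner (kinetic n x) x)) UNIV" .
  have "((\<lambda>k. \<Sum>x\<in>E. V k * (coord x k * coord x k)) has_sum (\<Sum>x\<in>E. inner (mult_ell2 V x) x)) UNIV"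
    by (intro has_sum_finite_sum has_sum_mult_ell2[OF VB])
  then have \<rho>_sum: "((\<lambda>k. V k * \<rho> k) has_sum (\<Sum>x\<in>E. inner (mult_ell2 V x) x)) UNIV"
    by (simp add: \<rho>_def sum_distrib_left power2_eq_square)
  have "((\<lambda>k. - q k) has_sum - (\<Sum>x\<in>E. inner (kinetic n x) x)) UNIV"
    using q_sum by (simp add: has_sum_uminus)
  from has_sum_add[OF \<rho>_sum this]
  have lhs: "((\<lambda>k. V k * \<rho> k - q k) has_sum (\<Sum>x\<in>E. - inner (kinetic n x - mult_ell2 V x) x)) UNIV"
    by (simp add: inner_diff_left sum_subtractf)
  have "V k * \<rho> k - q k
      \<le> C * ((1 - \<theta>) powr (1 - \<theta>) / (2 - \<theta>) powr (2 - \<theta>)) * V k powr (2 - \<theta>)" for k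
  proof (rule lieb_thirring_pointwise[OF \<theta> _ _ _ V(1)])
    show "0 \<le> C"
      using C by (simp add: interp_admissible_def)
    show "0 \<le> \<rho> k"
      by (simp add: \<rho>_def sum_nonneg)
    show "0 \<le> q k"
      by (simp add: q_def inner_kinetic)
    have "inner x (y k) = coord x k" if "x \<in> E" for x
    proof -
      have "inner x (y k) = (\<Sum>z\<in>E. if z = x then coord x k else 0)"
        unfolding y_def inner_sum_right using that by (intro sum.cong) (auto simp: delta)
      then show ?thesis
        using that E(1) by simp
    qed
    then have "(norm (y k))\<^sup>2 = \<rho> k"
      unfolding power2_norm_eq_inner by (subst (1) y_def)
        (simp add: inner_sum_left \<rho>_def power2_eq_square)
    then have "norm (y k) powr (2 * \<theta>) = \<rho> k powr \<theta>"
      by (simp add: powr_double)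
    moreover have "Dn_norm n (coord (y k)) powr (2 * (1 - \<theta>)) = q k powr (1 - \<theta>)"
      by (simp only: powr_double[OF Dn_norm_nonneg] q_def inner_kinetic)
    moreover have "coord (y k) k = \<rho> k"
      by (simp add: y_def \<rho>_def power2_eq_square)
    ultimately show "(\<rho> k)\<^sup>2 \<le> C * \<rho> k powr \<theta> * q k powr (1 - \<theta>)"
      using interp_admissible_bound[OF C, of "y k" k] by simp
  qed
  then show ?thesis
    by (intro has_sum_mono[OF lhs has_sum_cmult_right[OF has_sum_infsum[OF summable]]])
qed


section \<open>The discrete Schroedinger operator\<close>

text \<open>A ball lies in a cube with finitely many lattice points; hence decay at infinity leaves
  only finitely many sites where \<open>V\<close> exceeds a positive level.\<close>

lemma finite_lattice_norm_less: "finite {k :: int ^ 'd::finite. lattice_norm k < R}"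
proof -
  let ?I = "{- \<lceil>R\<rceil>..\<lceil>R\<rceil>}"
  have "{k :: int ^ 'd. lattice_norm k < R} \<subseteq> vec_lambda ` (UNIV \<rightarrow>\<^sub>E ?I)"
  proof
    fix k :: "int ^ 'd" assume "k \<in> {k. lattice_norm k < R}"
    then have "\<bar>real_of_int (k $ i)\<bar> < R" for i
      using component_le_norm_cart[of "\<chi> i. real_of_int (k $ i)" i]
      by (simp add: lattice_norm_def)
    then have "k $ i \<in> ?I" for i
      by (smt (verit) atLeastAtMost_iff ceiling_correct of_int_less_iff of_int_minus of_int_abs)
    then have "vec_nth k \<in> UNIV \<rightarrow>\<^sub>E ?I"
      by auto
    then show "k \<in> vec_lambda ` (UNIV \<rightarrow>\<^sub>E ?I)"
      by (metis imageI vec_nth_inverse)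
  qed
  then show ?thesis
    by (rule finite_subset) (intro finite_imageI finite_PiE; simp)
qed

text \<open>Testing with the unit vector at 0 gives \<open>1 \<le> C * D\<close>;
  \<open>D + 1\<close> avoids division by 0. Positivity ensures that the right side of the estimate
  is infinite when the potential sum is.\<close>

lemma sharp_const_pos:
  fixes n :: nat and \<theta> :: real
  shows "0 < sharp_const TYPE('d::finite) n \<theta>"
proof -
  define u where "u k = (if k = 0 then 1 else 0 :: real)" for k :: "int ^ 'd"
  have hs: "((\<lambda>k. (u k)\<^sup>2) has_sum 1) UNIV"
    by (rule has_sum_finite_neutralI[of "{0}"]) (auto simp: u_def)
  then have u: "u \<in> l2" "l2_norm u = 1"
    by (auto simp: l2_def l2_norm_def summable_on_def infsumI)
  define D where "D = Dn_norm n u powr (2 * (1 - \<theta>))"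
  have "D \<ge> 0"
    by (simp add: D_def)
  have "1 / (D + 1) \<le> C" if C: "interp_admissible TYPE('d) n \<theta> C" for C
  proof -
    have "1 \<le> C * D"
      using interp_admissible_bound[OF C, of "Abs_ell2 u" 0] u
      by (simp add: norm_ell2_eq_l2_norm Abs_ell2_inverse D_def u_def[of 0])
    moreover have "0 \<le> C"
      using C by (simp add: interp_admissible_def)
    ultimately show ?thesis
      using \<open>D \<ge> 0\<close> by (simp add: field_simps)
  qed
  then have "ennreal (1 / (D + 1)) \<le> sharp_const TYPE('d) n \<theta>"
    unfolding sharp_const_def by (intro Inf_greatest) (auto intro: ennreal_leI)
  moreover have "0 < ennreal (1 / (D + 1))"
    using \<open>D \<ge> 0\<close> by simp
  ultimately show ?thesis
    by (rule less_le_trans[rotated])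
qed

theorem theorem6p4:
  fixes V :: "int ^ 'd::finite \<Rightarrow> real" and n :: nat and \<theta> :: real
  assumes "\<theta> < 1"
    and "(CARD('d) = 1 \<and> n \<ge> 1 \<and> \<theta> \<in> {1 - 1 / (2 * real n)..1}) \<or>
         (CARD('d) = 2 \<and> n = 1 \<and> \<theta> \<in> {0<..1}) \<or>
         (CARD('d) \<ge> 3 \<and> n = 1 \<and> \<theta> \<in> {0..1})"
    and "\<And>k. V k \<ge> 0"
    and "(V \<longlongrightarrow> 0) (filtercomap lattice_norm at_top)"
  shows "discrete_negative_spectrum (schroedinger n V) \<and>
    negative_eigenvalue_sum (schroedinger n V)
      \<le> sharp_const TYPE('d) n \<theta>
         * ennreal ((1 - \<theta>) powr (1 - \<theta>) / (2 - \<theta>) powr (2 - \<theta>))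
         * (\<Sum>\<^sub>\<infinity>k. ennreal (V k powr (2 - \<theta>)))"
proof -
  have \<theta>: "0 \<le> \<theta>"
  proof -
    \<comment> \<open>In dimension one the lower end of the range of \<theta> is nonnegative because
      \<open>n \<ge> 1\<close>.\<close>
    have "1 / (2 * real n) \<le> 1" if "n \<ge> 1"
      using that by simp
    moreover have "1 - 1 / (2 * real n) \<le> \<theta> \<and> n \<ge> 1 \<or> 0 \<le> \<theta>"
      using assms(2) by auto
    ultimately show ?thesis
      by linarith
  qed
  have fin: "finite {k. V k \<ge> \<epsilon>}" if "\<epsilon> > 0" for \<epsilon>
  proof -
    have "\<forall>\<^sub>F k in filtercomap lattice_norm at_top. dist (V k) 0 < \<epsilon>"
      using assms(4) that by (rule tendstoD)
    then obtain R where "\<And>k. lattice_norm k \<ge> R \<Longrightarrow> dist (V k) 0 < \<epsilon>"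
      unfolding eventually_filtercomap_at_top_linorder by blast
    then have "{k. V k \<ge> \<epsilon>} \<subseteq> {k. lattice_norm k < R}"
      using assms(3) by (force simp: not_le[symmetric])
    then show ?thesis
      using finite_lattice_norm_less finite_subset by blast
  qed
  \<comment> \<open>A crude upper bound: only finitely many values reach 1, and each is at most
    their sum.\<close>
  define B where "B = 1 + (\<Sum>k\<in>{k. V k \<ge> 1}. V k)"
  have V_le: "V k \<le> B" for k
  proof (cases "V k \<ge> 1")
    case True
    then have "V k \<le> (\<Sum>k\<in>{k. V k \<ge> 1}. V k)"
      using fin[of 1] assms(3) by (intro member_le_sum) auto
    then show ?thesis
      by (simp add: B_def)
  next
    case False
    moreover have "0 \<le> (\<Sum>k\<in>{k. V k \<ge> 1}. V k)"
      by (intro sum_nonneg assms(3))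
    ultimately show ?thesis
      by (simp add: B_def)
  qed
  have VB: "\<bar>V k\<bar> \<le> B" for k
    using assms(3)[of k] V_le[of k] by simp
  define T where "T x = kinetic n x - mult_ell2 V x" for x
  have lift: "coord (T x) = schroedinger n V (coord x)" for x
    by (simp add: T_def fun_eq_iff schroedinger_def kinetic_def coord_mult_ell2[OF VB]
        coord_laplacian_ell2_power)
  have form: "\<exists>F (\<phi> :: int ^ 'd \<Rightarrow> (int ^ 'd) ell2 \<Rightarrow> real) M. form_bounded_below T F \<phi> c M"
    if "c < 0" for c
  proof -
    have "form_bounded_below (\<lambda>x. kinetic n x - mult_ell2 V x) {k. V k \<ge> - c} (\<lambda>k x. coord x k) (- (- c)) B"
      by (rule schroedinger_form_bounded_below[OF VB bounded_linear_kinetic kinetic_sym])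
        (use that fin in \<open>auto simp: inner_kinetic\<close>)
    then show ?thesis
      unfolding T_def[abs_def] minus_minus by blast
  qed
  define c where "c = (1 - \<theta>) powr (1 - \<theta>) / (2 - \<theta>) powr (2 - \<theta>)"
  define S where "S = (\<Sum>\<^sub>\<infinity>k. ennreal (V k powr (2 - \<theta>)))"
  have "c > 0"
    using assms(1) by (simp add: c_def)
  have "negative_eigenvalue_sum (schroedinger n V) \<le> sharp_const TYPE('d) n \<theta> * ennreal c * S"
  proof (cases "S = top")
    case True
    have "sharp_const TYPE('d) n \<theta> * ennreal c \<noteq> 0"
      using sharp_const_pos[where 'd = 'd, of n \<theta>] \<open>c > 0\<close> by auto
    then show ?thesis
      by (simp add: True ennreal_mult_top)
  next
    case False
    \<comment> \<open>A finite \<open>ennreal\<close> sum is turned into a real one, since the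
      estimate for orthonormal systems is stated over the reals.\<close>
    have partial: "(\<Sum>k\<in>F. V k powr (2 - \<theta>)) \<le> enn2real S" if "finite F" for F
    proof -
      have "ennreal (\<Sum>k\<in>F. V k powr (2 - \<theta>)) = (\<Sum>k\<in>F. ennreal (V k powr (2 - \<theta>)))"
        by (simp add: sum_ennreal)
      also have "\<dots> \<le> S"
        unfolding S_def by (subst nonneg_infsum_complete) (use that in \<open>auto intro: SUP_upper\<close>)
      also have "\<dots> = ennreal (enn2real S)"
        using False by (simp add: less_top)
      finally show ?thesis
        by (simp add: enn2real_nonneg)
    qed
    have summable: "(\<lambda>k. V k powr (2 - \<theta>)) summable_on UNIV"
      by (rule nonneg_bounded_partial_sums_imp_summable_on[where C = "enn2real S"])
        (use partial in \<open>auto intro: eventually_finite_subsets_at_top_weakI\<close>)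
    define s where "s = (\<Sum>\<^sub>\<infinity>k. V k powr (2 - \<theta>))"
    have "s \<le> enn2real S"
      unfolding s_def using summable partial by (intro infsum_le_finite_sums) auto
    then have sS: "ennreal s \<le> S"
      using False by (metis ennreal_enn2real ennreal_leI less_top)
    have "s \<ge> 0"
      by (simp add: s_def infsum_nonneg)
    have "negative_eigenvalue_sum (schroedinger n V) \<le> sharp_const TYPE('d) n \<theta> * ennreal (c * s)"
    \<comment> \<open>Here the right side is 0 even for an infinite sharp constant, and
      \<open>c * s\<close> cannot be divided by. Instead \<open>V = 0\<close>, so the form of
      \<open>T\<close> is nonnegative.\<close>
    proof (cases "s = 0")
      case True
      then have "V k powr (2 - \<theta>) = 0" for k
        using nonneg_infsum_le_0D[of "\<lambda>k. V k powr (2 - \<theta>)" UNIV k] summable by (simp add: s_def)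
      then have "V k = 0" for k
        by simp
      then have "mult_ell2 V x = 0" for x
        by (simp add: coord_inject[symmetric] fun_eq_iff coord_mult_ell2[OF VB])
      then have "(\<Sum>x\<in>E. - inner (T x) x) \<le> 0" for E
        by (intro sum_nonpos) (simp add: T_def inner_kinetic)
      then have "negative_eigenvalue_sum (schroedinger n V) \<le> 0"
        by (intro negative_eigenvalue_sum_le_ell2[of T, OF lift form]) (auto simp: ennreal_neg)
      then show ?thesis
        by simp
    next
      case False
      then have "c * s > 0"
        using \<open>c > 0\<close> \<open>s \<ge> 0\<close> by simp
      have bound: "negative_eigenvalue_sum (schroedinger n V) \<le> ennreal (C * (c * s))"
        if C: "interp_admissible TYPE('d) n \<theta> C" for C
      proof (rule negative_eigenvalue_sum_le_ell2[of T, OF lift form])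
        fix E :: "(int ^ 'd) ell2 set"
        assume "finite E" "pairwise orthogonal E" "\<And>x. x \<in> E \<Longrightarrow> norm x = 1"
        then show "ennreal (\<Sum>x\<in>E. - inner (T x) x) \<le> ennreal (C * (c * s))"
          unfolding T_def s_def c_def mult.assoc[symmetric]
          by (intro ennreal_leI lieb_thirring_orthonormal[OF \<theta> assms(1) C assms(3) V_le summable])
      qed
      \<comment> \<open>Dividing by the positive finite \<open>c * s\<close> isolates
        \<open>C\<close>, so the infimum over admissible constants can be taken; this also covers an
        empty set of constants, whose infimum is infinite.\<close>
      have "negative_eigenvalue_sum (schroedinger n V) / ennreal (c * s) \<le> ennreal C"
        if C: "interp_admissible TYPE('d) n \<theta> C" for C
      proof -
        have "0 \<le> C"
          using C by (simp add: interp_admissible_def)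
        have "negative_eigenvalue_sum (schroedinger n V) \<le> ennreal C * ennreal (c * s)"
          using bound[OF C] \<open>0 \<le> C\<close> \<open>c * s > 0\<close> by (simp add: ennreal_mult)
        then show ?thesis
          using \<open>c * s > 0\<close> by (intro divide_le_posI_ennreal) (simp_all add: mult.commute)
      qed
      then have "negative_eigenvalue_sum (schroedinger n V) / ennreal (c * s) \<le> sharp_const TYPE('d) n \<theta>"
        unfolding sharp_const_def by (intro Inf_greatest) auto
      then have "negative_eigenvalue_sum (schroedinger n V) / ennreal (c * s) * ennreal (c * s)
          \<le> sharp_const TYPE('d) n \<theta> * ennreal (c * s)"
        by (rule mult_right_mono) simp
      moreover have "ennreal (c * s) / ennreal (c * s) = 1"
        by (rule ennreal_divide_self) (simp_all only: ennreal_eq_0_iff not_le \<open>c * s > 0\<close> ennreal_less_top)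
      ultimately show ?thesis
        by (simp add: ennreal_divide_times)
    qed
    also have "\<dots> = sharp_const TYPE('d) n \<theta> * ennreal c * ennreal s"
      using \<open>c > 0\<close> \<open>s \<ge> 0\<close> by (simp add: ennreal_mult mult.assoc)
    also have "\<dots> \<le> sharp_const TYPE('d) n \<theta> * ennreal c * S"
      by (intro mult_left_mono sS) simp
    finally show ?thesis .
  qed
  moreover have "discrete_negative_spectrum (schroedinger n V)"
    by (rule discrete_negative_spectrum_ell2[of T, OF lift form])
  ultimately show ?thesis
    by (simp add: c_def S_def)
qed

end
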